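(* Let $P=\langle x\mid x=xx\rangle$, $w=xxx$, and let $g\in D(P,w)$ be the specific 4-cell diagram described in the context. If $y$ is any point of $K(P,w)$, then the distance $d(y,gy)$ in $K(P,w)$ is bigger than $\sqrt2$. If $y$ is a vertex then $d(y,gy)\ge 2$, and if $y$ is the midpoint of a cube then $d(y,gy)\ge\sqrt{2.25}$.
   Context: Diagrams over $P=\langle x\mid x=xx\rangle$. A degenerate diagram is a left-to-right path of $m\ge1$ edges, each labelled $x$; its top and bottom labels are both $x^m$. There are two kinds of cells: the upper cell $C(x,xx)$ and the lower cell $C(xx,x)$, where a cell $C(u,v)$ is a planar disk bounded by a top path labelled $u$ and a bottom path labelled $v$, with common left and right endpoints, both oriented left to right. A diagram is obtained from a degenerate diagram by successively attaching finitely many cells from below: a cell $C(u,v)$ is attached by identifying its top path with a subpath labelled $u$ of the current bottom path, and that subpath is replaced in the bottom path by the bottom path of the cell. Diagrams are considered up to label-preserving planar isotopy. $top(U)$, $bot(U)$ are the words labelling the top and bottom paths of $U$. If a diagram contains cells $C_1=C(u,v)$ and $C_2=C(v,u)$ such that the bottom path of $C_1$ is the top path of $C_2$, they may be cancelled (remove the middle path and identify the top path of $C_1$ with the bottom path of $C_2$). A diagram is reduced if no cancellation is possible; every diagram has a unique reduced form. If $bot(U)=top(V)$, $U\circ V$ is the concatenation ($V$ placed under $U$) and $UV$ is its reduced form. For reduced diagrams, $H<W$ ($H$ is a prefix of $W$; $H=W$ allowed) means $W=H\circ F$ for some diagram $F$. A diagram is thin if the top path of each of its cells is contained in the top path of the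 diagram. Cube complex. $\mathcal V(P,w)$ is the set of reduced diagrams $U$ with $top(U)=w$. The cube complex $K(P,w)$ has vertex set $\mathcal V(P,w)$; for each $U\in\mathcal V(P,w)$ and each thin diagram $\Phi$ with $top(\Phi)=bot(U)$ having $k$ cells there is a $k$-dimensional cube with vertex set $C(U,\Phi)=\{UV: V<\Phi\}$ (the prefixes of $\Phi$ correspond to subsets of its set of cells, giving the cube structure). Each $k$-cube carries the metric of the Euclidean unit cube $[0,1]^k$, and $K(P,w)$ carries the induced length metric $d$. $D(P,w)$ is the group of reduced diagrams $h$ with $top(h)=bot(h)=w$ under the product $UV$; it acts on $K(P,w)$ by isometries, $h$ sending a vertex $U$ to $hU$, extended affinely on each cube. The element $g$: starting from the path $xxx$, attach successively from below: a cell $C(x,xx)$ along the 1st edge (bottom becomes $x^4$); a cell $C(x,xx)$ along the 2nd edge of the current bottom path (bottom becomes $x^5$); a cell $C(xx,x)$ along the 3rd and 4th edges (bottom becomes $x^4$); a cell $C(xx,x)$ along the 3rd and 4th edges (bottom becomes $x^3$). The resulting reduced diagram with 4 cells is $g$. *)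

theory Defs
  imports Complex_Main
begin

text \<open>
  Diagrams over \<open>P = \<langle>x | x = xx\<rangle>\<close>. The alphabet has one letter, so the word \<open>x\<^sup>m\<close> is represented
  by the number \<open>m\<close>, and every edge is implicitly labelled \<open>x\<close>.

  Diagrams up to planar isotopy are represented by canonical names. In a diagram every edge is on
  the top path of at most one cell, so a cell can be named by its top path (a list of one edge
  for an upper cell \<open>C(x,xx)\<close>, of two edges for a lower cell \<open>C(xx,x)\<close>). An edge is either the
  \<open>i\<close>-th edge of the top path of the diagram, named \<open>Src i\<close>, or the \<open>j\<close>-th edge of the bottom path
  of the cell with top path \<open>p\<close>, named \<open>Out p j\<close> (all indices start from 0). The names depend
  only on the planar structure and not on the order in which independent cells are attached, and they
  determine it; so two diagrams are isotopic iff their representations are equal.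
\<close>

datatype edge = Src nat | Out "edge list" nat

type_synonym cell = "edge list"

datatype cell_kind = Upper | Lower

fun kind_top :: "cell_kind \<Rightarrow> nat" where
  "kind_top Upper = 1"
| "kind_top Lower = 2"

definition cell_bottom :: "cell \<Rightarrow> edge list" where
  "cell_bottom c = (if length c = 1 then [Out c 0, Out c 1] else [Out c 0])"

datatype diagram =
  Diagram (top_word: nat) (cells: "cell set") (bottom_path: "edge list")

definition top_path :: "diagram \<Rightarrow> edge list" where
  "top_path U = map Src [0..<top_word U]"

definition bot_word :: "diagram \<Rightarrow> nat" where
  "bot_word U = length (bottom_path U)"

definition degenerate :: "nat \<Rightarrow> diagram" where
  "degenerate m = Diagram m {} (map Src [0..<m])"

text \<open>\<open>attach k i U\<close> attaches a cell of kind \<open>k\<close> from below, its top path starting at the \<open>i\<close>-th edge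
  of the bottom path of \<open>U\<close>.\<close>

definition attach :: "cell_kind \<Rightarrow> nat \<Rightarrow> diagram \<Rightarrow> diagram" where
  "attach k i U =
    (let b = bottom_path U; c = take (kind_top k) (drop i b)
     in Diagram (top_word U) (insert c (cells U))
          (take i b @ cell_bottom c @ drop (i + kind_top k) b))"

inductive is_diagram :: "diagram \<Rightarrow> bool" where
  degenerate: "1 \<le> m \<Longrightarrow> is_diagram (degenerate m)"
| attach: "is_diagram U \<Longrightarrow> i + kind_top k \<le> bot_word U \<Longrightarrow> is_diagram (attach k i U)"

text \<open>Concatenation: the \<open>i\<close>-th edge of the top path of the lower diagram is identified with
  the \<open>i\<close>-th edge of the bottom path \<open>b\<close> of the upper one.\<close>

primrec glue :: "edge list \<Rightarrow> edge \<Rightarrow> edge" where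
  "glue b (Src i) = b ! i"
| "glue b (Out p j) = Out (map (glue b) p) j"

definition concatenation :: "diagram \<Rightarrow> diagram \<Rightarrow> diagram" (infixl "\<circ>\<^sub>D" 70) where
  "U \<circ>\<^sub>D V = Diagram (top_word U)
     (cells U \<union> map (glue (bottom_path U)) ` cells V)
     (map (glue (bottom_path U)) (bottom_path V))"

text \<open>
  A cancellable pair consists of cells \<open>C\<^sub>1 = c\<close> and \<open>C\<^sub>2 = cell_bottom c\<close>: as cells are named by their
  top paths, the latter is the cell whose top path is the bottom path of \<open>c\<close>, and it is
  automatically of the kind opposite to \<open>c\<close>. Cancelling removes both and identifies the \<open>j\<close>-th edge of
  the bottom path of \<open>C\<^sub>2\<close> with the \<open>j\<close>-th edge of the top path of \<open>C\<^sub>1\<close>.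
\<close>

definition cancellable :: "diagram \<Rightarrow> cell \<Rightarrow> bool" where
  "cancellable U c \<longleftrightarrow> c \<in> cells U \<and> cell_bottom c \<in> cells U"

primrec contract :: "cell \<Rightarrow> edge \<Rightarrow> edge" where
  "contract c (Src i) = Src i"
| "contract c (Out p j) = (if p = cell_bottom c then c ! j else Out (map (contract c) p) j)"

definition cancel :: "diagram \<Rightarrow> cell \<Rightarrow> diagram" where
  "cancel U c = Diagram (top_word U)
     (map (contract c) ` (cells U - {c, cell_bottom c}))
     (map (contract c) (bottom_path U))"

definition cancels_to :: "diagram \<Rightarrow> diagram \<Rightarrow> bool" where
  "cancels_to U V \<longleftrightarrow> (\<exists>c. cancellable U c \<and> V = cancel U c)"

definition reduced :: "diagram \<Rightarrow> bool" where
  "reduced U \<longleftrightarrow> (\<forall>c. \<not> cancellable U c)"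

definition reduced_form :: "diagram \<Rightarrow> diagram" where
  "reduced_form U = (THE V. cancels_to\<^sup>*\<^sup>* U V \<and> reduced V)"

definition diagram_product :: "diagram \<Rightarrow> diagram \<Rightarrow> diagram" (infixl "\<odot>" 70) where
  "U \<odot> V = reduced_form (U \<circ>\<^sub>D V)"

definition is_prefix :: "diagram \<Rightarrow> diagram \<Rightarrow> bool" where
  "is_prefix H W \<longleftrightarrow> is_diagram H \<and>
     (\<exists>F. is_diagram F \<and> bot_word H = top_word F \<and> W = H \<circ>\<^sub>D F)"

definition thin :: "diagram \<Rightarrow> bool" where
  "thin U \<longleftrightarrow> (\<forall>c\<in>cells U. set c \<subseteq> set (top_path U))"

definition diagram_group :: "nat \<Rightarrow> diagram set" where
  "diagram_group w = {h. is_diagram h \<and> reduced h \<and> top_word h = w \<and> bot_word h = w}"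

definition vertices :: "nat \<Rightarrow> diagram set" where
  "vertices w = {U. is_diagram U \<and> reduced U \<and> top_word U = w}"

definition is_cube :: "nat \<Rightarrow> diagram \<Rightarrow> diagram \<Rightarrow> bool" where
  "is_cube w U \<Phi> \<longleftrightarrow>
     U \<in> vertices w \<and> is_diagram \<Phi> \<and> thin \<Phi> \<and> top_word \<Phi> = bot_word U"

text \<open>
  Points of the complex. The cube \<open>C(U,\<Phi>)\<close> has one coordinate \<open>t c \<in> [0,1]\<close> for each cell \<open>c\<close> of \<open>\<Phi>\<close>,
  and its vertices are the \<open>U \<odot> V\<close> with \<open>V\<close> a prefix of \<open>\<Phi>\<close>; by the choice of names, \<open>cells V\<close> is
  literally the subset of \<open>cells \<Phi>\<close> corresponding to \<open>V\<close>. The vertex \<open>U \<odot> V\<close> has coordinates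
  \<open>1\<close> on \<open>cells V\<close> and \<open>0\<close> on the other cells. A point is represented by its multilinear weights on
  the vertices: the point with coordinates \<open>t\<close> has weight \<open>\<Prod>\<^sub>c\<^sub>\<in>\<^sub>V t c \<cdot> \<Prod>\<^sub>c\<^sub>\<notin>\<^sub>V (1 - t c)\<close> at \<open>U \<odot> V\<close>.
  The support of this function is the vertex set of the smallest face containing the point, and the
  function does not change when the point is viewed in another cube containing
  that face, or when the cube is written as \<open>C(U',\<Phi>')\<close> from another of its corners \<open>U'\<close>. So equality of
  weight functions is exactly the gluing of the cubes.
\<close>

type_synonym point = "diagram \<Rightarrow> real"

definition cube_point :: "diagram \<Rightarrow> diagram \<Rightarrow> (cell \<Rightarrow> real) \<Rightarrow> point" where
  "cube_point U \<Phi> t = (\<lambda>W. \<Sum>V | is_prefix V \<Phi> \<and> U \<odot> V = W.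
     (\<Prod>c\<in>cells V. t c) * (\<Prod>c\<in>cells \<Phi> - cells V. 1 - t c))"

definition cube_coords :: "diagram \<Rightarrow> (cell \<Rightarrow> real) \<Rightarrow> bool" where
  "cube_coords \<Phi> t \<longleftrightarrow> (\<forall>c\<in>cells \<Phi>. 0 \<le> t c \<and> t c \<le> 1)"

definition cube_complex :: "nat \<Rightarrow> point set" where
  "cube_complex w = {cube_point U \<Phi> t | U \<Phi> t. is_cube w U \<Phi> \<and> cube_coords \<Phi> t}"

definition vertex_point :: "diagram \<Rightarrow> point" where
  "vertex_point U = (\<lambda>W. of_bool (W = U))"

definition cube_midpoints :: "nat \<Rightarrow> point set" where
  "cube_midpoints w = {cube_point U \<Phi> (\<lambda>_. 1/2) | U \<Phi>. is_cube w U \<Phi>}"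

text \<open>
  The length metric: \<open>d(y,z)\<close> is the infimum of the lengths of the strings
  \<open>y = y\<^sub>0, y\<^sub>1, ..., y\<^sub>n = z\<close> such that any two consecutive points lie in a common cube, the length
  of a string being the sum of the Euclidean distances of consecutive points in these cubes.
\<close>

inductive string_length :: "nat \<Rightarrow> point \<Rightarrow> point \<Rightarrow> real \<Rightarrow> bool" for w where
  refl: "y \<in> cube_complex w \<Longrightarrow> string_length w y y 0"
| step: "is_cube w U \<Phi> \<Longrightarrow> cube_coords \<Phi> s \<Longrightarrow> cube_coords \<Phi> t \<Longrightarrow>
    string_length w (cube_point U \<Phi> t) z r \<Longrightarrow>
    string_length w (cube_point U \<Phi> s) z (sqrt (\<Sum>c\<in>cells \<Phi>. (s c - t c)\<^sup>2) + r)"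

definition complex_dist :: "nat \<Rightarrow> point \<Rightarrow> point \<Rightarrow> real" where
  "complex_dist w y z = Inf {r. string_length w y z r}"

text \<open>The action on points is the affine extension of \<open>U \<mapsto> h \<odot> U\<close>, that is, the pushforward of
  the (finitely supported) weights.\<close>

definition act :: "diagram \<Rightarrow> point \<Rightarrow> point" where
  "act h y = (\<lambda>W. \<Sum>U | y U \<noteq> 0 \<and> h \<odot> U = W. y U)"

definition g_elem :: diagram where
  "g_elem = attach Lower 2 (attach Lower 2 (attach Upper 1 (attach Upper 0 (degenerate 3))))"

lemma g_explicit:
  "g_elem = Diagram 3
     {[Out [Out [Out [Src 0] 1] 1, Src 1] 0, Src 2], [Out [Out [Src 0] 1] 1, Src 1],
      [Out [Src 0] 1], [Src 0]}
     [Out [Src 0] 0, Out [Out [Src 0] 1] 0,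
      Out [Out [Out [Out [Src 0] 1] 1, Src 1] 0, Src 2] 0]"
proof -
  have "[0..<3] = [0, 1, 2::nat]"
    by (simp add: upt_conv_Cons)
  then show ?thesis
    by (simp add: g_elem_def attach_def degenerate_def cell_bottom_def Let_def numeral_eq_Suc)
qed

lemma is_diagram_g: "is_diagram g_elem"
proof -
  have [simp]: "[0..<3] = [0, 1, 2::nat]"
    by (simp add: upt_conv_Cons)
  show ?thesis
    unfolding g_elem_def
    by (intro is_diagram.attach is_diagram.degenerate)
      (simp_all add: attach_def degenerate_def bot_word_def cell_bottom_def Let_def numeral_eq_Suc)
qed

lemma g_in_diagram_group: "g_elem \<in> diagram_group 3"
proof -
  have "\<forall>c\<in>cells g_elem. cell_bottom c \<notin> cells g_elem"
    by (simp add: g_explicit cell_bottom_def)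
  then have "reduced g_elem"
    by (auto simp: reduced_def cancellable_def)
  then show ?thesis
    using is_diagram_g by (simp add: diagram_group_def g_explicit bot_word_def)
qed

lemma card_cells_g: "card (cells g_elem) = 4"
  by (simp add: g_explicit)

end

theory Submission
  imports Defs "HOL-Analysis.Convex" "HOL-Analysis.L2_Norm"
begin

text \<open>
  Read \<open>Out [a] 0\<close>, \<open>Out [a] 1\<close> and \<open>Out [a, b] 0\<close> as \<open>\<lambda>a\<close>, \<open>\<rho>a\<close> and \<open>\<mu>(a, b)\<close> in the Cantor algebra with
  \<open>\<lambda>\<mu>(a, b) = a\<close>, \<open>\<rho>\<mu>(a, b) = b\<close>, \<open>\<mu>(\<lambda>a, \<rho>a) = a\<close>. A diagram is determined by its bottom path, it is reduced iff
  the edges of this path are terms in normal form, and the product substitutes and normalizes. Hence the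
  product is associative, and the group acts.

  For the distance bound no curvature is needed, only a map from the complex to a Euclidean space that does
  not increase lengths. Adding a cell to a reduced diagram crosses a hyperplane, which is named by
  that cell or by the cell inverse to it, and the crossing number of a hyperplane is an affine
  coordinate. Two orbits of hyperplanes under \<open>g\<close>, those of the second and third cell of \<open>g\<close>, are used
  coordinatewise: each orbit is crossed exactly once on the way from \<open>y\<close> to \<open>gy\<close>. The
  other two cells of \<open>g\<close> act on the leftmost and rightmost edges of the bottom path; of these only
  the depths matter. Their difference grows by 2 under \<open>g\<close>, and after division by \<open>\<surd>2\<close> it can be added as a
  further coordinate, because at most two cells of a cube touch the ends of the path. So
  \<open>d(y, gy)\<^sup>2 \<ge> 2 + \<Sum>\<^sub>n d\<^sub>n\<^sup>2 + \<Sum>\<^sub>n e\<^sub>n\<^sup>2\<close>, where \<open>\<bar>\<Sum>\<^sub>n d\<^sub>n\<bar> = \<bar>\<Sum>\<^sub>n e\<^sub>n\<bar> = 1\<close>, and the displacements \<open>d\<^sub>n\<close> and \<open>e\<^sub>n\<close> are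
  integers if \<open>y\<close> is a vertex, and half-integers if \<open>y\<close> is the midpoint of a cube.
\<close>

section \<open>Edges, cells and bottom paths\<close>

definition valid :: "edge list \<Rightarrow> bool" where
  "valid p \<longleftrightarrow> length p = 1 \<or> length p = 2"

primrec cellset :: "edge \<Rightarrow> cell set" where
  "cellset (Src i) = {}"
| "cellset (Out p j) = insert p (\<Union> (set (map cellset p)))"

text \<open>For a bottom path this is the set of all cells of the diagram: every cell survives in
  the names of the edges that descend from it.\<close>

definition cellsof :: "edge list \<Rightarrow> cell set" where
  "cellsof L = (\<Union>e\<in>set L. cellset e)"

lemma cellsof_simps [simp]:
  "cellsof [] = {}" "cellsof (e # L) = cellset e \<union> cellsof L"
  "cellsof (K @ L) = cellsof K \<union> cellsof L"
  by (auto simp: cellsof_def)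

lemma cellset_Out [simp]: "cellset (Out p j) = insert p (cellsof p)"
  by (simp add: cellsof_def)

declare cellset.simps(2) [simp del]

lemma cellsof_Src [simp]: "cellsof (map Src L) = {}"
  by (auto simp: cellsof_def)

lemma finite_cellset: "finite (cellset e)"
  by (induction e) (auto simp: cellsof_def)

lemma finite_cellsof: "finite (cellsof L)"
  by (simp add: cellsof_def finite_cellset)

lemma Out_mem_cellsof: "Out q j \<in> set p \<Longrightarrow> q \<in> cellsof p"
  by (force simp: cellsof_def)

lemma cellset_closed: "p \<in> cellset e \<Longrightarrow> cellsof p \<subseteq> cellset e"
proof (induction e)
  case (Out q j)
  then consider "p = q" | e where "e \<in> set q" "p \<in> cellset e"
    by (auto simp: cellsof_def)
  then show ?case
  proof cases
    case 2
    then have "cellsof p \<subseteq> cellset e"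
      using Out.IH by blast
    then show ?thesis
      using 2 by (auto simp: cellsof_def)
  qed auto
qed simp

lemma cellsof_closed: "p \<in> cellsof L \<Longrightarrow> cellsof p \<subseteq> cellsof L"
  using cellset_closed by (fastforce simp: cellsof_def)

lemma size_mem: "e \<in> set p \<Longrightarrow> size e < size (Out p j)"
  by (induction p) auto

lemma Out_in_own_top: "Out p j \<notin> set p"
  using size_mem[of "Out p j" p j] by auto

lemma valid_cases [consumes 1, case_names single double]:
  assumes "valid p"
  obtains a where "p = [a]" | a b where "p = [a, b]"
  using assms by (auto simp: valid_def length_Suc_conv eval_nat_numeral)

lemma valid_simps [simp]: "valid [a]" "valid [a, b]" "\<not> valid []" "\<not> valid (a # b # c # L)"
  by (auto simp: valid_def)

lemma valid_map [simp]: "valid (map f p) = valid p"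
  by (simp add: valid_def)

lemma cell_bottom_simps [simp]:
  "cell_bottom [a] = [Out [a] 0, Out [a] 1]" "cell_bottom [a, b] = [Out [a, b] 0]"
  by (auto simp: cell_bottom_def)

lemma cellsof_cell_bottom [simp]: "cellsof (cell_bottom c) = insert c (cellsof c)"
  by (auto simp: cell_bottom_def)

lemma hd_cell_bottom [simp]: "hd (cell_bottom c) = Out c 0"
  by (simp add: cell_bottom_def)

lemma cell_bottom_eq_iff [simp]: "cell_bottom c = cell_bottom d \<longleftrightarrow> c = d"
  by (metis edge.inject(2) hd_cell_bottom)

lemma valid_cell_bottom [simp]: "valid (cell_bottom c)"
  by (simp add: cell_bottom_def)

lemma length_cell_bottom: "valid c \<Longrightarrow> length (cell_bottom c) = 3 - length c"
  by (auto elim: valid_cases)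

lemma set_cell_bottom: "e \<in> set (cell_bottom c) \<Longrightarrow> \<exists>j. e = Out c j"
  by (auto simp: cell_bottom_def split: if_splits)

lemma valid_ne: "valid p \<Longrightarrow> p \<noteq> []"
  by auto

section \<open>Diagrams encoded by their bottom paths\<close>

definition mk :: "nat \<Rightarrow> edge list \<Rightarrow> diagram" where
  "mk m L = Diagram m (cellsof L) L"

lemma mk_simps [simp]: "top_word (mk m L) = m" "cells (mk m L) = cellsof L"
  "bottom_path (mk m L) = L" "bot_word (mk m L) = length L"
  by (simp_all add: mk_def bot_word_def)

inductive path :: "nat \<Rightarrow> edge list \<Rightarrow> bool" for m where
  base: "1 \<le> m \<Longrightarrow> path m (map Src [0..<m])"
| step: "path m (X @ q @ Y) \<Longrightarrow> valid q \<Longrightarrow> path m (X @ cell_bottom q @ Y)"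

text \<open>Attaching a cell replaces its top path by edges whose names contain that top path. So no
  cell is lost from the names on the bottom path, and the cell set can be recovered from
  them.\<close>

lemma is_diagram_imp: "is_diagram U \<Longrightarrow> path (top_word U) (bottom_path U) \<and> U = mk (top_word U) (bottom_path U)"
proof (induction rule: is_diagram.induct)
  case (degenerate m)
  then show ?case by (auto simp: degenerate_def mk_def intro: path.base)
next
  case (attach U i k)
  let ?b = "bottom_path U"
  let ?c = "take (kind_top k) (drop i ?b)"
  have b: "?b = take i ?b @ ?c @ drop (i + kind_top k) ?b"
    by (metis append_take_drop_id drop_drop add.commute)
  have v: "valid ?c"
    using attach.hyps(2) by (cases k) (auto simp: valid_def bot_word_def)
  have c: "cells U = cellsof ?b"
    by (metis attach.IH mk_simps(2))
  have cc: "cellsof ?b = cellsof (take i ?b) \<union> cellsof ?c \<union> cellsof (drop (i + kind_top k) ?b)"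
    by (subst b) auto
  have "path (top_word U) (take i ?b @ cell_bottom ?c @ drop (i + kind_top k) ?b)"
    using attach.IH b v path.step by metis
  then show ?case
    using c cc by (auto simp: attach_def mk_def Let_def)
qed

lemma attach_mk:
  assumes "valid q" "k = (if length q = 1 then Upper else Lower)"
  shows "attach k (length X) (mk m (X @ q @ Y)) = mk m (X @ cell_bottom q @ Y)"
proof -
  have "length q = kind_top k"
    using assms by (auto simp: valid_def)
  then show ?thesis
    by (auto simp: attach_def mk_def Let_def)
qed

lemma path_is_diagram: "path m L \<Longrightarrow> is_diagram (mk m L)"
proof (induction rule: path.induct)
  case base
  then show ?case
    using is_diagram.degenerate[of m] by (simp add: degenerate_def mk_def)
next
  case (step X q Y)
  let ?k = "if length q = 1 then Upper else Lower"
  have "is_diagram (attach ?k (length X) (mk m (X @ q @ Y)))"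
    by (rule is_diagram.attach) (use step in \<open>auto simp: valid_def bot_word_def\<close>)
  then show ?case
    using attach_mk[OF step.hyps(2)] by simp
qed

lemma is_diagram_iff: "is_diagram U \<longleftrightarrow> path (top_word U) (bottom_path U) \<and> U = mk (top_word U) (bottom_path U)"
  using is_diagram_imp path_is_diagram by metis

lemma is_diagram_mk [simp]: "is_diagram (mk m L) \<longleftrightarrow> path m L"
  by (simp add: is_diagram_iff)

lemma is_diagramE:
  assumes "is_diagram U" obtains L where "U = mk (top_word U) L" "path (top_word U) L"
  using assms is_diagram_iff by metis

lemma path_ne: "path m L \<Longrightarrow> L \<noteq> []"
  by (induction rule: path.induct) (auto simp: cell_bottom_def)

lemma not_disjoint_segment: "q \<noteq> [] \<Longrightarrow> set q \<inter> set (X @ q @ Y) \<noteq> {}"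
  by (cases q) auto

lemma path_planar: "path m L \<Longrightarrow> distinct L \<and> (\<forall>p\<in>cellsof L. set p \<inter> set L = {} \<and> valid p)"
proof (induction rule: path.induct)
  case base
  then show ?case by (auto simp: distinct_map inj_on_def)
next
  case (step X q Y)
  let ?L = "X @ q @ Y"
  have q: "q \<notin> cellsof ?L"
    using step.IH not_disjoint_segment[OF valid_ne[OF step.hyps(2)]] by blast
  have new: "Out q j \<notin> set X" "Out q j \<notin> set Y" for j
    using q Out_mem_cellsof by fastforce+
  have old: "Out q j \<notin> set p" if "p \<in> cellsof ?L" for p j
    using q cellsof_closed[OF that] Out_mem_cellsof by blast
  have "distinct (X @ cell_bottom q @ Y)"
    using step.IH new by (auto simp: cell_bottom_def)
  moreover have "set p \<inter> set (X @ cell_bottom q @ Y) = {} \<and> valid p"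
    if "p \<in> cellsof (X @ cell_bottom q @ Y)" for p
  proof (cases "p = q")
    case True
    then show ?thesis
      using step.IH step.hyps Out_in_own_top by (auto simp: cell_bottom_def)
  next
    case False
    then have p: "p \<in> cellsof ?L"
      using that by auto
    then have "set p \<inter> set ?L = {}" "valid p"
      using step.IH by auto
    moreover have "set p \<inter> set (cell_bottom q) = {}"
      using old[OF p] by (auto dest: set_cell_bottom)
    ultimately show ?thesis
      by auto
  qed
  ultimately show ?case by blast
qed

lemma path_top_not_cell: "path m (X @ q @ Y) \<Longrightarrow> valid q \<Longrightarrow> q \<notin> cellsof (X @ q @ Y)"
  using path_planar[of m "X @ q @ Y"] not_disjoint_segment[OF valid_ne, of q X Y] by auto

text \<open>The edges of a cell bottom carry the cell in their names and are numbered from 0, so two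
  such segments of a list cannot overlap partially.\<close>

lemma append_bottom_cases1:
  assumes "us @ cell_bottom c @ B = cell_bottom d @ B'"
  shows "(us = [] \<and> c = d \<and> B = B') \<or> (\<exists>M. us = cell_bottom d @ M \<and> B' = M @ cell_bottom c @ B)"
proof (cases us)
  case Nil
  then have "hd (cell_bottom c) = hd (cell_bottom d)"
    using assms by (simp add: cell_bottom_def split: if_splits)
  then show ?thesis using assms Nil by simp
next
  case (Cons u vs)
  then show ?thesis
    using assms by (cases vs) (auto simp: cell_bottom_def split: if_splits)
qed

lemma append_bottom_cases:
  assumes "A @ cell_bottom c @ B = A' @ cell_bottom d @ B'"
  shows "(A = A' \<and> c = d \<and> B = B') \<or> (\<exists>M. A' = A @ cell_bottom c @ M \<and> B = M @ cell_bottom d @ B')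
    \<or> (\<exists>M. A = A' @ cell_bottom d @ M \<and> B' = M @ cell_bottom c @ B)"
proof -
  from assms obtain us where
    "(A = A' @ us \<and> us @ cell_bottom c @ B = cell_bottom d @ B') \<or>
     (A @ us = A' \<and> cell_bottom c @ B = us @ cell_bottom d @ B')"
    unfolding append_eq_append_conv2 by blast
  then show ?thesis
    using append_bottom_cases1[of us c B d B'] append_bottom_cases1[of us d B' c B] by auto
qed

text \<open>A cell whose whole bottom lies on the current path can be removed even if it was not
  attached last: by \<open>append_bottom_cases\<close> later attachments took place beside it, and
  they can be repeated after its removal.\<close>

lemma path_peel:
  assumes "path m (X @ cell_bottom c @ Y)" "valid c"
  shows "path m (X @ c @ Y)"
  using assms
proof (induction "X @ cell_bottom c @ Y" arbitrary: X Y rule: path.induct)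
  case base
  then have "Out c 0 \<in> set (map Src [0..<m])"
    by (simp add: cell_bottom_def split: if_splits)
  then show ?case by auto
next
  case (step A q B)
  from append_bottom_cases[OF step.hyps(4)]
  consider "A = X" "q = c" "B = Y"
    | M where "X = A @ cell_bottom q @ M" "B = M @ cell_bottom c @ Y"
    | M where "A = X @ cell_bottom c @ M" "Y = M @ cell_bottom q @ B"
    by blast
  then show ?case
  proof cases
    case 1
    then show ?thesis using step by simp
  next
    case 2
    then have "path m ((A @ q @ M) @ c @ Y)"
      using step.hyps(2)[of "A @ q @ M" Y] step.prems by simp
    then show ?thesis
      using 2 path.step[of m A q "M @ c @ Y"] step.hyps by simp
  next
    case 3
    then have "path m (X @ c @ (M @ q @ B))"
      using step.hyps(2)[of X "M @ q @ B"] step.prems by simp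
    then show ?thesis
      using 3 path.step[of m "X @ c @ M" q B] step.hyps by simp
  qed
qed

section \<open>Normal forms and reduction\<close>

text \<open>The effect, on a segment \<open>p\<close> of the bottom path of a reduced diagram, of
  attaching a cell along \<open>p\<close> and reducing: if \<open>p\<close> is the bottom of a cell,
  the new cell cancels that one, otherwise it stays.\<close>

definition flip :: "edge list \<Rightarrow> edge list" where
  "flip p = (if p \<in> range cell_bottom then inv cell_bottom p else cell_bottom p)"

lemma flip_cell_bottom [simp]: "flip (cell_bottom c) = c"
  by (simp add: flip_def inv_f_f inj_def)

lemma flip_top: "p \<notin> range cell_bottom \<Longrightarrow> flip p = cell_bottom p"
  by (simp add: flip_def)

primrec well_formed :: "nat \<Rightarrow> edge \<Rightarrow> bool" where
  "well_formed m (Src i) \<longleftrightarrow> i < m"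
| "well_formed m (Out p j) \<longleftrightarrow> valid p \<and> j < 3 - length p \<and> list_all id (map (well_formed m) p)"

lemma well_formed_Out [simp]:
  "well_formed m (Out p j) \<longleftrightarrow> valid p \<and> j < 3 - length p \<and> (\<forall>e\<in>set p. well_formed m e)"
  by (auto simp: list_all_iff)

declare well_formed.simps(2) [simp del]

definition normal :: "nat \<Rightarrow> edge \<Rightarrow> bool" where
  "normal m e \<longleftrightarrow> well_formed m e \<and> cellset e \<inter> range cell_bottom = {}"

lemma normal_simps [simp]:
  "normal m (Src i) \<longleftrightarrow> i < m"
  "normal m (Out p j) \<longleftrightarrow> valid p \<and> j < 3 - length p \<and> (\<forall>e\<in>set p. normal m e) \<and> p \<notin> range cell_bottom"
  by (auto simp: normal_def cellsof_def)

definition normal_top :: "nat \<Rightarrow> edge list \<Rightarrow> bool" where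
  "normal_top m p \<longleftrightarrow> valid p \<and> (\<forall>e\<in>set p. normal m e)"

lemma normal_topD: "normal_top m p \<Longrightarrow> valid p" "normal_top m p \<Longrightarrow> e \<in> set p \<Longrightarrow> normal m e"
  by (auto simp: normal_top_def)

lemma normal_top_cell_bottom: "normal_top m (cell_bottom c) \<longleftrightarrow> normal_top m c \<and> c \<notin> range cell_bottom"
proof -
  have "(\<forall>e\<in>set (cell_bottom c). normal m e) \<longleftrightarrow> normal m (Out c 0) \<and> (length c = 1 \<longrightarrow> normal m (Out c 1))"
    by (simp add: cell_bottom_def del: normal_simps)
  also have "\<dots> \<longleftrightarrow> normal_top m c \<and> c \<notin> range cell_bottom"
    unfolding normal_simps normal_top_def by (auto simp del: cell_bottom_simps elim: valid_cases)
  finally show ?thesis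
    by (simp add: normal_top_def)
qed

lemma normal_top_cases [consumes 1, case_names top bottom]:
  assumes "normal_top m p"
  obtains "p \<notin> range cell_bottom" "flip p = cell_bottom p"
  | c where "p = cell_bottom c" "normal_top m c" "flip c = cell_bottom c" "c \<notin> range cell_bottom"
proof (cases "p \<in> range cell_bottom")
  case True
  then obtain c where "p = cell_bottom c" by auto
  then show ?thesis using that assms normal_top_cell_bottom flip_top by blast
qed (simp add: that flip_top)

text \<open>If \<open>p\<close> is the bottom of \<open>c\<close>, then normality of the edges of
  \<open>p\<close> prevents \<open>c\<close> from being a cell bottom itself, so a second flip leads
  from \<open>c\<close> back to \<open>p\<close>.\<close>

lemma flip_normal_top:
  assumes "normal_top m p"
  shows "flip (flip p) = p" "normal_top m (flip p)" "length (flip p) = 3 - length p"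
proof -
  have "flip (flip p) = p \<and> normal_top m (flip p) \<and> length (flip p) = 3 - length p"
    using assms
  proof (cases rule: normal_top_cases)
    case top
    then show ?thesis
      using assms normal_top_cell_bottom length_cell_bottom[OF normal_topD(1)[OF assms]] by simp
  next
    case (bottom c)
    then show ?thesis
      using length_cell_bottom[OF normal_topD(1)[OF bottom(2)]] normal_topD(1)[OF bottom(2)]
      by (auto simp: valid_def)
  qed
  then show "flip (flip p) = p" "normal_top m (flip p)" "length (flip p) = 3 - length p"
    by simp_all
qed

text \<open>Simultaneous substitution and normalization: source edges are replaced by means of
  \<open>\<sigma>\<close>, and each cell acts by \<open>flip\<close>, so that it cancels at once
  where possible. Thus \<open>ev Src\<close> gives normal forms, and \<open>ev ((!) L)\<close> glues
  below the path \<open>L\<close> and reduces.\<close>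

primrec ev :: "(nat \<Rightarrow> edge) \<Rightarrow> edge \<Rightarrow> edge" where
  "ev \<sigma> (Src i) = \<sigma> i"
| "ev \<sigma> (Out p j) = flip (map (ev \<sigma>) p) ! j"

lemma ev_normal:
  assumes "\<And>i. i < n \<Longrightarrow> normal m (\<sigma> i)"
  shows "well_formed n e \<Longrightarrow> normal m (ev \<sigma> e)"
proof (induction e)
  case (Out p j)
  then have "normal_top m (map (ev \<sigma>) p)"
    by (auto simp: normal_top_def)
  from flip_normal_top[OF this] Out.prems show ?case
    by (auto simp: normal_top_def)
qed (use assms in auto)

lemma map_ev_cell_bottom:
  assumes "normal_top m (map (ev \<sigma>) c)"
  shows "map (ev \<sigma>) (cell_bottom c) = flip (map (ev \<sigma>) c)"
proof -
  have "length (flip (map (ev \<sigma>) c)) = 3 - length c" "valid c"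
    using flip_normal_top(3)[OF assms] normal_topD(1)[OF assms] by auto
  then show ?thesis
    by (intro nth_equalityI) (auto elim!: valid_cases simp: less_Suc_eq)
qed

lemma normal_well_formed: "normal m e \<Longrightarrow> well_formed m e"
  by (simp add: normal_def)

lemma normal_top_map_ev:
  assumes "\<And>i. i < n \<Longrightarrow> normal m (\<sigma> i)" "normal_top n c"
  shows "normal_top m (map (ev \<sigma>) c)"
  using assms ev_normal[of n m \<sigma>] by (auto simp: normal_top_def intro: normal_well_formed)

text \<open>For a top path that is no cell bottom this is how \<open>ev\<close> treats a cell; for
  the bottom of a cell \<open>d\<close> it follows by applying the involution \<open>flip\<close> to
  the statement for \<open>d\<close>.\<close>

lemma map_ev_flip:
  assumes "\<And>i. i < n \<Longrightarrow> normal m (\<sigma> i)" "normal_top n c"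
  shows "map (ev \<sigma>) (flip c) = flip (map (ev \<sigma>) c)"
  using assms(2)
proof (cases rule: normal_top_cases)
  case top
  then show ?thesis
    using map_ev_cell_bottom[OF normal_top_map_ev[OF assms]] by simp
next
  case (bottom d)
  have d: "normal_top m (map (ev \<sigma>) d)"
    by (rule normal_top_map_ev[OF assms(1) bottom(2)])
  show ?thesis
    using map_ev_cell_bottom[OF d] flip_normal_top(1)[OF d] bottom by simp
qed

text \<open>Substitution can be done in two rounds because \<open>ev\<close> commutes with
  \<open>flip\<close> on normal top paths. Associativity of the product rests on this.\<close>

lemma ev_ev:
  assumes "\<And>i. i < n \<Longrightarrow> normal m (\<sigma> i)" "\<And>i. i < m \<Longrightarrow> normal k (\<tau> i)"
  shows "well_formed n e \<Longrightarrow> ev \<tau> (ev \<sigma> e) = ev (\<lambda>i. ev \<tau> (\<sigma> i)) e"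
proof (induction e)
  case (Out p j)
  have p: "normal_top m (map (ev \<sigma>) p)"
    using Out.prems ev_normal[OF assms(1)] by (auto simp: normal_top_def)
  have "j < length (flip (map (ev \<sigma>) p))"
    using flip_normal_top(3)[OF p] Out.prems by simp
  then have "ev \<tau> (ev \<sigma> (Out p j)) = map (ev \<tau>) (flip (map (ev \<sigma>) p)) ! j"
    by simp
  also have "\<dots> = flip (map (ev \<tau>) (map (ev \<sigma>) p)) ! j"
    using map_ev_flip[OF assms(2) p] by simp
  also have "map (ev \<tau>) (map (ev \<sigma>) p) = map (ev (\<lambda>i. ev \<tau> (\<sigma> i))) p"
    using Out by simp
  finally show ?case by simp
qed simp

lemma nth_cell_bottom: "valid c \<Longrightarrow> j < 3 - length c \<Longrightarrow> cell_bottom c ! j = Out c j"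
  by (auto elim!: valid_cases simp: less_2_cases_iff)

lemma ev_Src: "normal m e \<Longrightarrow> ev Src e = e"
proof (induction e)
  case (Out p j)
  have "map (ev Src) p = p"
    by (rule map_idI) (use Out in auto)
  moreover have "flip p = cell_bottom p" "cell_bottom p ! j = Out p j"
    using Out.prems flip_top nth_cell_bottom by auto
  ultimately show ?case
    by simp
qed simp

lemma map_ev_Src: "\<forall>e\<in>set L. normal m e \<Longrightarrow> map (ev Src) L = L"
  using ev_Src[of m] by (simp add: map_idI)

lemma ev_glue:
  assumes "\<forall>e\<in>set b. normal m e"
  shows "well_formed (length b) e \<Longrightarrow> ev Src (glue b e) = ev ((!) b) e"
proof (induction e)
  case (Src i)
  then show ?case using assms ev_Src[of m "b ! i"] by simp
next
  case (Out p j)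
  then have "map (ev Src) (map (glue b) p) = map (ev ((!) b)) p"
    by simp
  then show ?case by (simp only: glue.simps ev.simps)
qed

lemma nf_normal: "well_formed m e \<Longrightarrow> normal m (ev Src e)"
  by (rule ev_normal) auto

lemma normal_top_nf: "valid c \<Longrightarrow> \<forall>e\<in>set c. well_formed m e \<Longrightarrow> normal_top m (map (ev Src) c)"
  by (simp add: normal_top_def nf_normal)

text \<open>An edge directly below a cancelled pair is evaluated by two flips that undo each other.
  So a cancellation keeps the normal form, and this invariant makes the reduced form unique.\<close>

lemma ev_contract: "well_formed m e \<Longrightarrow> ev Src (contract c e) = ev Src e"
proof (induction e)
  case (Out p j)
  show ?case
  proof (cases "p = cell_bottom c")
    case True
    have c: "valid c" "\<forall>e\<in>set c. well_formed m e" "j < length c"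
      using True Out.prems by (auto simp: cell_bottom_def valid_def split: if_splits)
    have n: "normal_top m (map (ev Src) c)"
      by (rule normal_top_nf) (use c in auto)
    have "ev Src (Out p j) = flip (map (ev Src) (cell_bottom c)) ! j"
      using True by simp
    also have "\<dots> = map (ev Src) c ! j"
      using map_ev_cell_bottom[OF n] flip_normal_top(1)[OF n] by simp
    finally show ?thesis
      using True c by simp
  next
    case False
    have "map (ev Src) (map (contract c) p) = map (ev Src) p"
      using Out by simp
    then show ?thesis
      using False by (simp only: contract.simps ev.simps if_False)
  qed
qed simp

lemma path_well_formed: "path m L \<Longrightarrow> e \<in> set L \<Longrightarrow> well_formed m e"
proof (induction arbitrary: e rule: path.induct)
  case (step X q Y)
  then show ?case by (auto simp: cell_bottom_def valid_def split: if_splits)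
qed auto

lemma path_flip:
  assumes "path m (X @ q @ Y)" "valid q"
  shows "path m (X @ flip q @ Y)"
proof (cases "q \<in> range cell_bottom")
  case True
  then obtain c where c: "q = cell_bottom c" by auto
  have "Out c 0 \<in> set q"
    unfolding c by (simp add: cell_bottom_def)
  then have "valid c"
    using path_well_formed[OF assms(1), of "Out c 0"] by auto
  then show ?thesis
    using path_peel[of m X c Y] assms(1) by (simp add: c)
next
  case False
  then show ?thesis using path.step[OF assms] by (simp add: flip_top)
qed

text \<open>The attachments are repeated on normal forms with \<open>flip\<close> in place of
  \<open>cell_bottom\<close>; each flip attaches a cell or, by \<open>path_peel\<close>, removes
  one.\<close>

lemma path_normalize: "path m L \<Longrightarrow> path m (map (ev Src) L)"
proof (induction rule: path.induct)
  case base
  then show ?case using path.base by (simp add: comp_def)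
next
  case (step X q Y)
  have q: "normal_top m (map (ev Src) q)"
    by (rule normal_top_nf) (use step path_well_formed in auto)
  show ?case
    using path_flip[of m "map (ev Src) X" "map (ev Src) q" "map (ev Src) Y"] step
    by (simp add: map_ev_cell_bottom[OF q])
qed

lemma path_nf_normal: "path m L \<Longrightarrow> \<forall>e\<in>set (map (ev Src) L). normal m e"
  using path_well_formed nf_normal by auto

lemma cell_bottom_in_cellsof: "cell_bottom c \<in> cellsof L \<Longrightarrow> c \<in> cellsof L"
  using cellsof_closed[of "cell_bottom c" L] by auto

text \<open>If \<open>cell_bottom c\<close> is a cell of a bottom path, then so is \<open>c\<close>.
  Hence a cancellable pair is detected by its lower member alone.\<close>

lemma reduced_mk:
  assumes "path m L"
  shows "reduced (mk m L) \<longleftrightarrow> (\<forall>e\<in>set L. normal m e)"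
proof -
  have "reduced (mk m L) \<longleftrightarrow> cellsof L \<inter> range cell_bottom = {}"
    using cell_bottom_in_cellsof unfolding reduced_def cancellable_def mk_simps by blast
  also have "\<dots> \<longleftrightarrow> (\<forall>e\<in>set L. cellset e \<inter> range cell_bottom = {})"
    unfolding cellsof_def by blast
  finally show ?thesis
    using path_well_formed[OF assms] unfolding normal_def by blast
qed

section \<open>Cancellation and the reduced form\<close>

lemma contract_id: "cell_bottom c \<notin> cellset e \<Longrightarrow> contract c e = e"
proof (induction e)
  case (Out p j)
  then have "map (contract c) p = p"
    by (auto simp: cellsof_def intro!: map_idI)
  then show ?case using Out by auto
qed simp

lemma map_contract_id: "cell_bottom c \<notin> cellsof L \<Longrightarrow> map (contract c) L = L"
  by (auto simp: cellsof_def intro!: map_idI contract_id)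

text \<open>Induction on the attachments. If the last cell is the lower one of the pair, cancelling
  gives the path with both cells removed, which is obtained by peeling off \<open>c\<close>.
  Otherwise the pair is present before the last attachment, and contraction commutes with attaching
  \<open>q\<close>.\<close>

lemma contract_path:
  assumes "path m L" "c \<in> cellsof L" "cell_bottom c \<in> cellsof L"
  shows "path m (map (contract c) L) \<and>
    map (contract c) ` (cellsof L - {c, cell_bottom c}) = cellsof (map (contract c) L)"
  using assms
proof (induction rule: path.induct)
  case (step X q Y)
  let ?L = "X @ q @ Y"
  have q: "q \<notin> cellsof ?L"
    by (rule path_top_not_cell[OF step.hyps])
  show ?case
  proof (cases "q = cell_bottom c")
    case True
    have cb: "cell_bottom c \<notin> cellsof X" "cell_bottom c \<notin> cellsof Y"
      "cell_bottom c \<notin> cellsof (cell_bottom c)"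
      using q True by auto
    have c: "valid c"
      using path_well_formed[OF step.hyps(1), of "Out c 0"] True by (auto simp: cell_bottom_def)
    have cc: "cell_bottom c \<notin> cellsof c"
      using cb(3) by auto
    have 1: "map (contract c) (cell_bottom (cell_bottom c)) = c"
      using c map_contract_id[OF cc] contract_id
      by (auto elim!: valid_cases simp: cell_bottom_def)
    have p: "path m (X @ c @ Y)"
      using path_peel[OF _ c] step.hyps True by auto
    have cn: "c \<notin> cellsof (X @ c @ Y)"
      by (rule path_top_not_cell[OF p c])
    have "map (contract c) d = d" if "d \<in> cellsof (X @ c @ Y)" for d
      using that cellsof_closed[OF that] cb cc by (intro map_contract_id) auto
    then have "map (contract c) ` cellsof (X @ c @ Y) = cellsof (X @ c @ Y)"
      by auto
    moreover have "cellsof (X @ cell_bottom q @ Y) - {c, cell_bottom c} = cellsof (X @ c @ Y)"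
      using cn cb cc True by auto
    moreover have "map (contract c) (X @ cell_bottom q @ Y) = X @ c @ Y"
      using cb 1 True by (simp add: map_contract_id)
    ultimately show ?thesis
      using p by metis
  next
    case False
    \<comment> \<open>If \<open>q\<close> were \<open>c\<close>, then \<open>cell_bottom c\<close>
      would be among the earlier cells and would bring \<open>c\<close> with it, but
      \<open>q\<close> is new.\<close>
    have "q \<noteq> c"
      using step.prems False q cell_bottom_in_cellsof[of c ?L] by auto
    then have "c \<in> cellsof ?L" "cell_bottom c \<in> cellsof ?L"
      using step.prems False by auto
    note IH = step.IH[OF this]
    have 1: "map (contract c) (cell_bottom q) = cell_bottom (map (contract c) q)"
      using False by (auto simp: cell_bottom_def)
    have 2: "cellsof (X @ cell_bottom q @ Y) - {c, cell_bottom c} = insert q (cellsof ?L - {c, cell_bottom c})"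
      using False \<open>q \<noteq> c\<close> by auto
    show ?thesis
      unfolding 2 using IH path.step[of m "map (contract c) X" "map (contract c) q"] step.hyps
      by (auto simp: 1)
  qed
qed simp

lemma cancel_diagram:
  assumes "is_diagram U" "cancels_to U V"
  shows "is_diagram V" "top_word V = top_word U"
    "map (ev Src) (bottom_path V) = map (ev Src) (bottom_path U)"
    "card (cells V) < card (cells U)"
proof -
  obtain m L where U: "U = mk m L" "path m L"
    using assms(1) by (rule is_diagramE)
  obtain c where c: "c \<in> cellsof L" "cell_bottom c \<in> cellsof L" and V: "V = cancel U c"
    using assms(2) U by (auto simp: cancels_to_def cancellable_def)
  note 1 = contract_path[OF U(2) c]
  have V2: "V = mk m (map (contract c) L)"
    using 1 unfolding V cancel_def U mk_simps by (simp add: mk_def)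
  show "is_diagram V" "top_word V = top_word U"
    using 1 U by (auto simp: V2)
  show "map (ev Src) (bottom_path V) = map (ev Src) (bottom_path U)"
    using path_well_formed[OF U(2)] ev_contract by (auto simp: V2 U(1))
  have "card (cells V) \<le> card (cellsof L - {c, cell_bottom c})"
    using 1 by (metis V2 card_image_le finite_Diff finite_cellsof mk_simps(2))
  also have "\<dots> < card (cellsof L)"
    using c by (intro psubset_card_mono finite_cellsof) auto
  finally show "card (cells V) < card (cells U)"
    by (simp add: U)
qed

lemma cancels_to_rtranclp:
  assumes "cancels_to\<^sup>*\<^sup>* U V" "is_diagram U"
  shows "is_diagram V \<and> top_word V = top_word U \<and> map (ev Src) (bottom_path V) = map (ev Src) (bottom_path U)"
  using assms by (induction rule: rtranclp_induct) (auto dest: cancel_diagram)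

lemma ex_reduced: "is_diagram U \<Longrightarrow> \<exists>V. cancels_to\<^sup>*\<^sup>* U V \<and> reduced V"
proof (induction "card (cells U)" arbitrary: U rule: less_induct)
  case less
  show ?case
  proof (cases "reduced U")
    case False
    then obtain V where V: "cancels_to U V"
      by (auto simp: reduced_def cancels_to_def)
    then show ?thesis
      using less cancel_diagram by (meson converse_rtranclp_into_rtranclp)
  qed auto
qed

text \<open>Every cancellation lowers the number of cells, so some reduced diagram is reached. Its
  edges are normal, hence equal to their own normal forms, and these have not changed on the
  way.\<close>

lemma reduced_form_eq:
  assumes "is_diagram U"
  shows "reduced_form U = mk (top_word U) (map (ev Src) (bottom_path U))"
proof -
  have *: "V = mk (top_word U) (map (ev Src) (bottom_path U))" if "cancels_to\<^sup>*\<^sup>* U V" "reduced V" for V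
  proof -
    note 1 = cancels_to_rtranclp[OF that(1) assms]
    then obtain L where V: "V = mk (top_word U) L" "path (top_word U) L"
      using is_diagramE by metis
    then have "map (ev Src) L = L"
      using that(2) reduced_mk[OF V(2)] map_ev_Src[of L] V(1) by metis
    moreover have "map (ev Src) (bottom_path V) = map (ev Src) (bottom_path U)"
      using 1 by blast
    moreover have "bottom_path V = L"
      by (subst V(1)) simp
    ultimately show ?thesis
      using V(1) by simp
  qed
  obtain V where "cancels_to\<^sup>*\<^sup>* U V" "reduced V"
    using ex_reduced[OF assms] by auto
  then show ?thesis
    unfolding reduced_form_def by (intro the_equality) (use * in blast)+
qed

section \<open>Concatenation and product\<close>

lemma map_glue_cell_bottom: "map (glue b) (cell_bottom q) = cell_bottom (map (glue b) q)"
  by (simp add: cell_bottom_def)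

lemma path_glue:
  assumes "path m L" "path (length L) K"
  shows "path m (map (glue L) K) \<and> cellsof (map (glue L) K) = cellsof L \<union> map (glue L) ` cellsof K"
  using assms(2)
proof (induction rule: path.induct)
  case base
  have "map (glue L) (map Src [0..<length L]) = L"
    by (auto intro: nth_equalityI)
  then show ?case
    using assms(1) by simp
next
  case (step X q Y)
  then show ?case
    using path.step[of m "map (glue L) X" "map (glue L) q" "map (glue L) Y"]
    by (auto simp: map_glue_cell_bottom)
qed

lemma concatenation_mk:
  assumes "path m L" "path (length L) K"
  shows "mk m L \<circ>\<^sub>D mk (length L) K = mk m (map (glue L) K)"
  using path_glue[OF assms] by (simp add: concatenation_def) (simp add: mk_def)

lemma product_mk:
  assumes "path m L" "\<forall>e\<in>set L. normal m e" "path (length L) K"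
  shows "mk m L \<odot> mk (length L) K = mk m (map (ev ((!) L)) K)"
proof -
  have "map (ev Src) (map (glue L) K) = map (ev ((!) L)) K"
    using path_well_formed[OF assms(3)] ev_glue[OF assms(2)] by auto
  then show ?thesis
    unfolding diagram_product_def concatenation_mk[OF assms(1,3)]
    using path_glue[OF assms(1,3)] by (subst reduced_form_eq) (simp_all del: map_map)
qed

lemma path_product:
  assumes "path m L" "\<forall>e\<in>set L. normal m e" "path (length L) K"
  shows "path m (map (ev ((!) L)) K)" "\<forall>e\<in>set (map (ev ((!) L)) K). normal m e"
proof -
  have *: "map (ev Src) (map (glue L) K) = map (ev ((!) L)) K"
    using path_well_formed[OF assms(3)] ev_glue[OF assms(2)] by auto
  show "path m (map (ev ((!) L)) K)"
    using path_normalize[of m "map (glue L) K"] path_glue[OF assms(1,3)] by (simp only: *)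
  show "\<forall>e\<in>set (map (ev ((!) L)) K). normal m e"
    using path_nf_normal[of m "map (glue L) K"] path_glue[OF assms(1,3)] unfolding * by blast
qed

definition normal_path :: "nat \<Rightarrow> edge list \<Rightarrow> bool" where
  "normal_path m L \<longleftrightarrow> path m L \<and> (\<forall>e\<in>set L. normal m e)"

lemma vertices_eq: "vertices m = mk m ` {L. normal_path m L}"
proof (rule set_eqI)
  fix U
  show "U \<in> vertices m \<longleftrightarrow> U \<in> mk m ` {L. normal_path m L}"
  proof
    assume U: "U \<in> vertices m"
    then obtain L where "U = mk m L" "path m L"
      by (auto simp: vertices_def elim: is_diagramE)
    then show "U \<in> mk m ` {L. normal_path m L}"
      using U by (auto simp: vertices_def normal_path_def reduced_mk)
  qed (auto simp: vertices_def normal_path_def reduced_mk)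
qed

section \<open>Thin diagrams\<close>

text \<open>A thin diagram read from left to right: its top path \<open>T\<close> is cut into single
  edges that persist and into the top paths of the cells in \<open>C\<close>, and \<open>B\<close>
  is the resulting bottom path.\<close>

inductive tiling :: "edge list \<Rightarrow> cell set \<Rightarrow> edge list \<Rightarrow> bool" where
  Nil: "tiling [] {} []"
| skip: "tiling T C B \<Longrightarrow> tiling (a # T) C (a # B)"
| cell: "tiling T C B \<Longrightarrow> valid c \<Longrightarrow> tiling (c @ T) (insert c C) (cell_bottom c @ B)"

lemma tiling_cells: "tiling T C B \<Longrightarrow> c \<in> C \<Longrightarrow> valid c \<and> set c \<subseteq> set T"
  by (induction rule: tiling.induct) auto

lemma tiling_refl: "tiling T {} T"
  by (induction T) (auto intro: tiling.intros)

lemma tiling_empty: "tiling T C B \<Longrightarrow> C = {} \<Longrightarrow> B = T"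
  by (induction rule: tiling.induct) auto

lemma tiling_finite: "tiling T C B \<Longrightarrow> finite C"
  by (induction rule: tiling.induct) auto

lemma tiling_cellsof: "tiling T C B \<Longrightarrow> set T \<subseteq> range Src \<Longrightarrow> cellsof B = C"
proof (induction rule: tiling.induct)
  case (cell T C B c)
  then have "cellsof c = {}"
    by (auto simp: cellsof_def)
  then show ?case using cell by auto
qed auto

lemma tiling_skip_append: "tiling T C B \<Longrightarrow> tiling (c @ T) C (c @ B)"
  by (induction c) (auto intro: tiling.skip)

lemma tiling_Nil_iff: "tiling T C B \<Longrightarrow> B = [] \<longleftrightarrow> T = []"
  by (induction rule: tiling.induct) (auto simp: cell_bottom_def)

text \<open>Source edges never lie on the bottom of a cell, so the segment \<open>c\<close> consists
  of edges that the tiling has skipped, and a new cell can be placed there.\<close>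

lemma tiling_attach:
  assumes "tiling T C L" "L = A @ c @ B" "valid c" "set c \<subseteq> range Src"
  shows "tiling T (insert c C) (A @ cell_bottom c @ B)"
  using assms
proof (induction arbitrary: A rule: tiling.induct)
  case (skip T C L a)
  show ?case
  proof (cases A)
    case Nil
    from \<open>valid c\<close> show ?thesis
    proof (cases rule: valid_cases)
      case (single b)
      then show ?thesis
        using skip Nil tiling.cell[OF skip.hyps, of c] by simp
    next
      case (double b d)
      then have "tiling T C (d # B)" "a = b" "d \<in> range Src"
        using skip Nil by auto
      then obtain T' where "T = d # T'" "tiling T' C B"
        by (auto elim: tiling.cases simp: cell_bottom_def split: if_splits)
      then show ?thesis
        using tiling.cell[of T' C B c] double Nil \<open>a = b\<close> by simp
    qed
  next
    case (Cons a' A')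
    then show ?thesis
      using skip tiling.skip[of T "insert c C"] by auto
  qed
next
  case (cell T C L d)
  obtain s c' where c: "c = Src s # c'"
    using cell.prems by (cases c) auto
  have "\<exists>A'. A = cell_bottom d @ A' \<and> L = A' @ c @ B"
  proof -
    obtain us where "(cell_bottom d = A @ us \<and> us @ L = c @ B) \<or> (cell_bottom d @ us = A \<and> L = us @ c @ B)"
      using cell.prems(1) unfolding append_eq_append_conv2 by blast
    moreover have "us = []" if "cell_bottom d = A @ us" "us @ L = c @ B"
    proof (cases us)
      case (Cons u vs)
      then have "Src s \<in> set (cell_bottom d)"
        using that c by simp
      then show ?thesis
        by (auto dest: set_cell_bottom)
    qed
    ultimately show ?thesis by fastforce
  qed
  then obtain A' where A': "A = cell_bottom d @ A'" "L = A' @ c @ B"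
    by auto
  have "tiling (d @ T) (insert d (insert c C)) (cell_bottom d @ A' @ cell_bottom c @ B)"
    by (rule tiling.cell[OF cell.IH[OF A'(2) cell.prems(2,3)] cell.hyps(2)])
  then show ?case
    using A' by (simp add: insert_commute)
qed simp

definition srcs :: "nat \<Rightarrow> edge list" where
  "srcs n = map Src [0..<n]"

lemma srcs_simps [simp]: "set (srcs n) = Src ` {..<n}" "distinct (srcs n)" "length (srcs n) = n"
  by (auto simp: srcs_def distinct_map inj_on_def atLeast0LessThan)

lemma path_tiling:
  assumes "path m L" "\<forall>c\<in>cellsof L. set c \<subseteq> range Src"
  shows "tiling (srcs m) (cellsof L) L"
  using assms
proof (induction rule: path.induct)
  case base
  then show ?case using tiling_refl by (simp add: srcs_def)
next
  case (step X q Y)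
  then show ?case
    using tiling_attach[of "srcs m" "cellsof (X @ q @ Y)" _ X q Y] by auto
qed

lemma path_srcs: "path m L \<Longrightarrow> path m (srcs m)"
  by (induction rule: path.induct) (auto simp: srcs_def intro: path.base)

text \<open>As the edges of \<open>T\<close> are distinct, its first edge lies on at most one cell
  of \<open>C\<close>, and whether it does decides which rule of \<open>tiling\<close> comes
  first.\<close>

lemma tiling_unique:
  assumes "tiling T C B" "tiling T C B'" "distinct T"
  shows "B = B'"
  using assms
proof (induction arbitrary: B' rule: tiling.induct)
  case Nil
  then show ?case by (auto elim: tiling.cases)
next
  case (skip T C B a)
  from skip.prems(1) show ?case
  proof (cases rule: tiling.cases)
    case (skip B2)
    then show ?thesis using skip.IH skip.prems by auto
  next
    case (cell T2 C2 B2 c)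
    then have "set c \<subseteq> set T" "c \<noteq> []"
      using tiling_cells[OF skip.hyps, of c] by auto
    then show ?thesis
      using cell skip.prems(2) by (cases c) auto
  qed
next
  case (cell T C B c)
  obtain a c' where c: "c = a # c'"
    using cell.hyps by (cases c) auto
  have a: "a \<notin> set T"
    using c cell.prems by auto
  have cC: "c \<notin> C"
    using tiling_cells[OF cell.hyps(1), of c] a c by auto
  from cell.prems(1) show ?case
  proof (cases rule: tiling.cases)
    case Nil
    then show ?thesis using c by simp
  next
    case (skip T2 B2 b)
    then have "set c \<subseteq> set T2" "b = a"
      using tiling_cells[of T2 "insert c C" B2 c] c by auto
    then show ?thesis
      using skip cell.prems c by auto
  next
    case (cell T2 C2 B2 d)
    obtain d' where d: "d = a # d'"
      using cell c by (cases d) auto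
    have "d = c"
      using cell(2) tiling_cells[OF cell.hyps(1), of d] a d by auto
    then have T: "T2 = T"
      using cell by auto
    then have "c \<notin> C2"
      using tiling_cells[OF cell(4), of c] a c by auto
    then have "C2 = C"
      using insert_ident[OF _ cC, of C2] cell(2) \<open>d = c\<close> by simp
    then show ?thesis
      using cell.IH[of B2] cell(3,4) cell.prems \<open>d = c\<close> T by auto
  qed
qed

section \<open>Prefixes of thin diagrams\<close>

inductive attaches :: "edge list \<Rightarrow> edge list \<Rightarrow> bool" for K where
  refl: "attaches K K"
| step: "attaches K (X @ q @ Y) \<Longrightarrow> valid q \<Longrightarrow> attaches K (X @ cell_bottom q @ Y)"

lemma attaches_append: "attaches K L \<Longrightarrow> attaches (Z @ K) (Z @ L)"
proof (induction rule: attaches.induct)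
  case (step X q Y)
  then show ?case using attaches.step[of "Z @ K" "Z @ X" q Y] by simp
qed (rule attaches.refl)

lemma attaches_trans: "attaches L M \<Longrightarrow> attaches K L \<Longrightarrow> attaches K M"
  by (induction rule: attaches.induct) (auto intro: attaches.step)

lemma attaches_path: "attaches K L \<Longrightarrow> path m K \<Longrightarrow> path m L"
  by (induction rule: attaches.induct) (auto intro: path.step)

text \<open>The cells outside \<open>C'\<close> are left out at first and attached afterwards, which
  is possible since the cells of a tiling lie side by side.\<close>

lemma tiling_sub:
  assumes "tiling T C B" "C' \<subseteq> C"
  shows "\<exists>B'. tiling T C' B' \<and> attaches B' B"
  using assms
proof (induction arbitrary: C' rule: tiling.induct)
  case Nil
  then show ?case by (auto intro: tiling.Nil attaches.refl)
next
  case (skip T C B a)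
  then obtain B' where "tiling T C' B'" "attaches B' B"
    by blast
  then show ?case
    using attaches_append[of B' B "[a]"] by (auto intro!: exI[of _ "a # B'"] tiling.skip)
next
  case (cell T C B c)
  then have "C' - {c} \<subseteq> C"
    by auto
  then obtain B' where B': "tiling T (C' - {c}) B'" "attaches B' B"
    using cell.IH by blast
  note att = attaches_append[OF B'(2), of "cell_bottom c"]
  show ?case
  proof (cases "c \<in> C'")
    case True
    then have "tiling (c @ T) C' (cell_bottom c @ B')"
      using tiling.cell[OF B'(1) cell.hyps(2)] by (simp add: insert_absorb)
    then show ?thesis
      using att by blast
  next
    case False
    then have "tiling (c @ T) C' (c @ B')"
      using tiling_skip_append[OF B'(1), of c] by simp
    moreover have "attaches (c @ B') (cell_bottom c @ B')"
      using attaches.step[of "c @ B'" "[]" c B'] attaches.refl cell.hyps(2) by simp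
    ultimately show ?thesis
      using attaches_trans[OF att] by blast
  qed
qed

text \<open>The attachments below \<open>K\<close> are replayed on a fresh source path; the segment
  used in each step is pulled back by splitting the preimage list at the same places.\<close>

lemma attaches_glue:
  assumes "attaches K L" "K \<noteq> []"
  shows "\<exists>F. path (length K) F \<and> map (glue K) F = L"
  using assms
proof (induction rule: attaches.induct)
  case refl
  have "map (glue K) (map Src [0..<length K]) = K"
    by (auto intro: nth_equalityI)
  moreover have "path (length K) (map Src [0..<length K])"
    by (rule path.base) (use refl in \<open>simp add: Suc_leI\<close>)
  ultimately show ?case by blast
next
  case (step X q Y)
  then obtain F where F: "path (length K) F" "map (glue K) F = X @ q @ Y"
    by auto
  then obtain FX R where "F = FX @ R" "map (glue K) FX = X" "map (glue K) R = q @ Y"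
    by (metis map_eq_append_conv)
  moreover from this(3) obtain Fq FY where "R = Fq @ FY" "map (glue K) Fq = q" "map (glue K) FY = Y"
    by (metis map_eq_append_conv)
  ultimately have *: "F = FX @ Fq @ FY" "map (glue K) FX = X" "map (glue K) Fq = q" "map (glue K) FY = Y"
    by auto
  have "valid Fq"
    using step.hyps(2) *(3) valid_map by metis
  then have "path (length K) (FX @ cell_bottom Fq @ FY)"
    using path.step F(1) unfolding *(1) by blast
  moreover have "map (glue K) (FX @ cell_bottom Fq @ FY) = X @ cell_bottom q @ Y"
    using * by (simp add: map_glue_cell_bottom)
  ultimately show ?case by blast
qed

lemma is_prefix_mk:
  assumes "path n K" "attaches K B"
  shows "is_prefix (mk n K) (mk n B)"
proof -
  obtain F where F: "path (length K) F" "map (glue K) F = B"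
    using attaches_glue[OF assms(2) path_ne[OF assms(1)]] by blast
  then show ?thesis
    using concatenation_mk[OF assms(1) F(1)] assms(1)
    unfolding is_prefix_def by (intro conjI exI[of _ "mk (length K) F"]) auto
qed

lemma is_prefixD:
  assumes "is_prefix V W"
  shows "is_diagram V" "top_word V = top_word W" "cells V \<subseteq> cells W"
  using assms by (auto simp: is_prefix_def concatenation_def)

lemma top_path_srcs: "top_path U = srcs (top_word U)"
  by (simp add: top_path_def srcs_def)

lemma is_diagram_cells: "is_diagram U \<Longrightarrow> cells U = cellsof (bottom_path U)"
  using is_diagram_imp mk_simps(2) by metis

lemma thin_tiling:
  assumes "is_diagram V" "thin V"
  shows "tiling (srcs (top_word V)) (cells V) (bottom_path V)"
proof -
  have "\<forall>c\<in>cellsof (bottom_path V). set c \<subseteq> range Src"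
    using assms(2) by (force simp: thin_def top_path_srcs is_diagram_cells[OF assms(1)])
  then show ?thesis
    using path_tiling is_diagram_imp[OF assms(1)] is_diagram_cells[OF assms(1)] by metis
qed

lemma thin_prefix:
  assumes "thin W" "is_prefix V W"
  shows "thin V"
  using assms is_prefixD[OF assms(2)] by (auto simp: thin_def top_path_srcs)

text \<open>Injectivity is the uniqueness of a tiling with given cells, surjectivity the existence
  of a tiling by any subset of the cells.\<close>

lemma prefixes_bij:
  assumes "is_diagram \<Phi>" "thin \<Phi>"
  shows "bij_betw cells {V. is_prefix V \<Phi>} (Pow (cells \<Phi>))"
proof -
  let ?n = "top_word \<Phi>"
  have til: "tiling (srcs ?n) (cells V) (bottom_path V)" if "is_prefix V \<Phi>" for V
    using thin_tiling[OF is_prefixD(1)[OF that] thin_prefix[OF assms(2) that]] is_prefixD(2)[OF that]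
    by simp
  have "inj_on cells {V. is_prefix V \<Phi>}"
  proof (rule inj_onI)
    fix V W assume VW: "V \<in> {V. is_prefix V \<Phi>}" "W \<in> {V. is_prefix V \<Phi>}" "cells V = cells W"
    then have "bottom_path V = bottom_path W"
      using til[of V] til[of W] tiling_unique by auto
    then show "V = W"
      using VW is_prefixD(2) by (intro diagram.expand) auto
  qed
  moreover have "C \<in> cells ` {V. is_prefix V \<Phi>}" if C: "C \<subseteq> cells \<Phi>" for C
  proof -
    obtain K where K: "tiling (srcs ?n) C K" "attaches K (bottom_path \<Phi>)"
      using tiling_sub[OF thin_tiling[OF assms] C] by blast
    \<comment> \<open>For the empty set of cells, \<open>K0\<close> is the source path itself; as
      \<open>K\<close> arises from it by attaching, \<open>K\<close> is the bottom path of a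
      diagram.\<close>
    obtain K0 where K0: "tiling (srcs ?n) {} K0" "attaches K0 K"
      using tiling_sub[OF K(1)] by blast
    have "path ?n (srcs ?n)"
      using path_srcs is_diagram_imp[OF assms(1)] by blast
    then have "path ?n K"
      using K0 tiling_empty attaches_path by blast
    then have "is_prefix (mk ?n K) \<Phi>"
      using is_prefix_mk K(2) is_diagram_imp[OF assms(1)] by metis
    moreover have "cells (mk ?n K) = C"
      using tiling_cellsof[OF K(1)] by auto
    ultimately show ?thesis
      by blast
  qed
  moreover have "cells ` {V. is_prefix V \<Phi>} \<subseteq> Pow (cells \<Phi>)"
    using is_prefixD(3) by auto
  ultimately show ?thesis
    unfolding bij_betw_def by (intro conjI equalityI subsetI) (assumption, erule subsetD, assumption, simp)
qed

section \<open>Multilinear interpolation on a cube\<close>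

definition weight :: "(cell \<Rightarrow> real) \<Rightarrow> cell set \<Rightarrow> cell set \<Rightarrow> real" where
  "weight t A C = (\<Prod>c\<in>C. t c) * (\<Prod>c\<in>A - C. 1 - t c)"

lemma sum_Pow_weight_insert:
  assumes "finite A" "a \<notin> A"
  shows "(\<Sum>C\<in>Pow (insert a A). weight t (insert a A) C * F C) =
    (1 - t a) * (\<Sum>C\<in>Pow A. weight t A C * F C) + t a * (\<Sum>C\<in>Pow A. weight t A C * F (insert a C))"
proof -
  have inj: "inj_on (insert a) (Pow A)"
    using assms by (auto simp: inj_on_def)
  have 1: "weight t (insert a A) C = (1 - t a) * weight t A C" if "C \<subseteq> A" for C
  proof -
    have "insert a A - C = insert a (A - C)" "a \<notin> A - C" "finite (A - C)"
      using that assms by auto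
    then show ?thesis by (simp add: weight_def)
  qed
  have 2: "weight t (insert a A) (insert a C) = t a * weight t A C" if "C \<subseteq> A" for C
  proof -
    have "insert a A - insert a C = A - C" "a \<notin> C" "finite C"
      using that assms finite_subset by auto
    then show ?thesis by (simp add: weight_def)
  qed
  have "(\<Sum>C\<in>Pow (insert a A). weight t (insert a A) C * F C) =
    (\<Sum>C\<in>Pow A. weight t (insert a A) C * F C) + (\<Sum>C\<in>insert a ` Pow A. weight t (insert a A) C * F C)"
    unfolding Pow_insert by (rule sum.union_disjoint) (use assms in auto)
  then show ?thesis
    using 1 2 by (simp add: sum.reindex[OF inj] sum_distrib_left mult.assoc)
qed

lemma sum_weight: "finite A \<Longrightarrow> (\<Sum>C\<in>Pow A. weight t A C) = 1"
proof (induction rule: finite_induct)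
  case (insert a A)
  then show ?case using sum_Pow_weight_insert[of A a t "\<lambda>_. 1"] by simp
qed (simp add: weight_def)

text \<open>Multilinear interpolation reproduces affine functions. In the induction step the corners
  are split according to whether they contain \<open>a\<close>, and \<open>\<delta> a\<close> is
  absorbed into the constant \<open>k\<close>, which therefore is arbitrary.\<close>

lemma sum_weight_sum:
  "finite A \<Longrightarrow> (\<Sum>C\<in>Pow A. weight t A C * (k + (\<Sum>c\<in>C. \<delta> c))) = k + (\<Sum>c\<in>A. t c * \<delta> c)"
proof (induction arbitrary: k rule: finite_induct)
  case (insert a A)
  have "(\<Sum>C\<in>Pow A. weight t A C * (k + (\<Sum>c\<in>insert a C. \<delta> c))) =
    (\<Sum>C\<in>Pow A. weight t A C * ((k + \<delta> a) + (\<Sum>c\<in>C. \<delta> c)))"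
  proof (rule sum.cong[OF HOL.refl])
    fix C assume "C \<in> Pow A"
    then have "finite C" "a \<notin> C"
      using insert.hyps finite_subset by auto
    then show "weight t A C * (k + (\<Sum>c\<in>insert a C. \<delta> c)) = weight t A C * ((k + \<delta> a) + (\<Sum>c\<in>C. \<delta> c))"
      by simp
  qed
  also have "\<dots> = (k + \<delta> a) + (\<Sum>c\<in>A. t c * \<delta> c)"
    by (rule insert.IH)
  finally have "(\<Sum>C\<in>Pow (insert a A). weight t (insert a A) C * (k + (\<Sum>c\<in>C. \<delta> c))) =
    (1 - t a) * (k + (\<Sum>c\<in>A. t c * \<delta> c)) + t a * ((k + \<delta> a) + (\<Sum>c\<in>A. t c * \<delta> c))"
    unfolding sum_Pow_weight_insert[OF insert.hyps] insert.IH by simp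
  then show ?case
    using insert.hyps by (simp add: algebra_simps)
qed (simp add: weight_def)

section \<open>Cubes and the action\<close>

lemma normal_path_flip:
  assumes "normal_path m (X @ q @ Y)" "valid q"
  shows "normal_top m q" "normal_path m (X @ flip q @ Y)"
proof -
  show q: "normal_top m q"
    using assms by (auto simp: normal_path_def normal_top_def)
  show "normal_path m (X @ flip q @ Y)"
    using assms path_flip[of m X q Y] normal_topD(2)[OF flip_normal_top(2)[OF q]]
    by (auto simp: normal_path_def)
qed

text \<open>Taking the last cell off a reduced diagram leaves it reduced, so a reduced diagram is
  built up through reduced ones by attachments that never cancel; each such attachment is a
  flip.\<close>

lemma normal_path_induct [consumes 1, case_names base flip]:
  assumes "normal_path m L"
    and base: "P (srcs m)"
    and step: "\<And>X q Y. normal_path m (X @ q @ Y) \<Longrightarrow> valid q \<Longrightarrow> q \<notin> range cell_bottom \<Longrightarrow>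
      P (X @ q @ Y) \<Longrightarrow> P (X @ flip q @ Y)"
  shows "P L"
proof -
  have "path m L" "\<forall>e\<in>set L. normal m e"
    using assms by (auto simp: normal_path_def)
  then show ?thesis
  proof (induction rule: path.induct)
    case base
    then show ?case using assms(2) by (simp add: srcs_def)
  next
    case (step X q Y)
    have "normal_top m (cell_bottom q)"
      using step.prems by (auto simp: normal_top_def)
    then have q: "normal_top m q" "q \<notin> range cell_bottom"
      by (auto simp: normal_top_cell_bottom)
    then have "normal_path m (X @ q @ Y)"
      using step by (auto simp: normal_path_def normal_top_def)
    then show ?case
      using assms(3)[of X q Y] q step by (auto simp: normal_path_def flip_top)
  qed
qed

text \<open>
  The increment may depend on the cell and on whether it touches the left and the right end of the path.
\<close>

definition additive :: "nat \<Rightarrow> (edge list \<Rightarrow> real) \<Rightarrow> (bool \<Rightarrow> bool \<Rightarrow> edge list \<Rightarrow> real) \<Rightarrow> bool" where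
  "additive m f D \<longleftrightarrow> (\<forall>X q Y. normal_path m (X @ q @ Y) \<longrightarrow> valid q \<longrightarrow>
     f (X @ flip q @ Y) = f (X @ q @ Y) + D (X = []) (Y = []) q)"

lemma additiveD:
  "additive m f D \<Longrightarrow> normal_path m (X @ q @ Y) \<Longrightarrow> valid q \<Longrightarrow>
    f (X @ flip q @ Y) = f (X @ q @ Y) + D (X = []) (Y = []) q"
  by (simp add: additive_def)

text \<open>
  \<open>P\<close> is the part of the top path already passed, and \<open>X\<close> what has become of it. It only serves
  to recognize the cells at the two ends.
\<close>

lemma additive_tiling:
  assumes "tiling T C B" "additive m f D" "distinct (P @ T)" "normal_path m (X @ map \<sigma> T)" "X = [] \<longleftrightarrow> P = []"
    "\<And>c. c \<in> C \<Longrightarrow> map \<sigma> (cell_bottom c) = flip (map \<sigma> c)"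
  shows "normal_path m (X @ map \<sigma> B) \<and> f (X @ map \<sigma> B) = f (X @ map \<sigma> T) +
    (\<Sum>c\<in>C. D (hd (P @ T) \<in> set c) (last (P @ T) \<in> set c) (map \<sigma> c))"
  using assms
proof (induction arbitrary: X P rule: tiling.induct)
  case (skip T C B a)
  then show ?case
    using skip.IH[of "P @ [a]" "X @ [\<sigma> a]"] by simp
next
  case (cell T C B c)
  let ?d = "\<lambda>c'. D (hd (P @ c @ T) \<in> set c') (last (P @ c @ T) \<in> set c') (map \<sigma> c')"
  have c: "c \<noteq> []"
    using cell.hyps by auto
  have IH: "normal_path m (X @ map \<sigma> c @ map \<sigma> B) \<and>
    f (X @ map \<sigma> c @ map \<sigma> B) = f (X @ map \<sigma> c @ map \<sigma> T) + (\<Sum>c'\<in>C. ?d c')"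
    using cell.IH[of "P @ c" "X @ map \<sigma> c"] cell.prems c by simp
  have "map \<sigma> (cell_bottom c @ B) = flip (map \<sigma> c) @ map \<sigma> B"
    using cell.prems(5)[of c] by simp
  moreover have "normal_path m (X @ flip (map \<sigma> c) @ map \<sigma> B)"
    using normal_path_flip(2)[of m X "map \<sigma> c"] IH cell.hyps(2) by simp
  moreover have "f (X @ flip (map \<sigma> c) @ map \<sigma> B) = f (X @ map \<sigma> c @ map \<sigma> B) + D (X = []) (map \<sigma> B = []) (map \<sigma> c)"
    using additiveD[OF cell.prems(1)] IH cell.hyps(2) by simp
  moreover have "X = [] \<longleftrightarrow> hd (P @ c @ T) \<in> set c"
    using cell.prems(2,4) c by (cases P) auto
  moreover have "map \<sigma> B = [] \<longleftrightarrow> last (P @ c @ T) \<in> set c"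
    using tiling_Nil_iff[OF cell.hyps(1)] cell.prems(2) c last_in_set[of T] by (cases "T = []") auto
  moreover have "c \<notin> C"
    using tiling_cells[OF cell.hyps(1), of c] cell.prems(2) c by (cases c) auto
  ultimately show ?case
    using IH tiling_finite[OF cell.hyps(1)] by simp
qed simp

lemma map_ev_srcs: "map (ev ((!) L)) (srcs (length L)) = L"
  by (auto simp: srcs_def intro: nth_equalityI)

lemma hd_srcs: "n > 0 \<Longrightarrow> hd (srcs n) = Src 0"
  and last_srcs: "n > 0 \<Longrightarrow> last (srcs n) = Src (n - 1)"
  by (simp_all add: srcs_def hd_map last_map)

lemma normal_path_ne: "normal_path m L \<Longrightarrow> L \<noteq> []"
  using path_ne by (auto simp: normal_path_def)

lemma normal_nth: "normal_path m L \<Longrightarrow> i < length L \<Longrightarrow> normal m (L ! i)"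
  by (simp add: normal_path_def)

lemma map_ev_cell_bottom_srcs:
  assumes "normal_path m L" "valid c" "set c \<subseteq> set (srcs (length L))"
  shows "map (ev ((!) L)) (cell_bottom c) = flip (map (ev ((!) L)) c)"
  using assms by (intro map_ev_cell_bottom[where m = m]) (auto simp: normal_top_def normal_nth)

lemma product_normal:
  assumes "normal_path m L" "is_diagram V" "top_word V = length L"
  shows "mk m L \<odot> V = mk m (map (ev ((!) L)) (bottom_path V))"
    "normal_path m (map (ev ((!) L)) (bottom_path V))"
proof -
  have L: "path m L" "\<forall>e\<in>set L. normal m e"
    using assms(1) by (auto simp: normal_path_def)
  have V: "path (length L) (bottom_path V)" "V = mk (length L) (bottom_path V)"
    using is_diagram_imp[OF assms(2)] assms(3) by auto
  show "mk m L \<odot> V = mk m (map (ev ((!) L)) (bottom_path V))"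
    using product_mk[OF L V(1)] V(2) by metis
  show "normal_path m (map (ev ((!) L)) (bottom_path V))"
    using path_product[OF L V(1)] by (simp add: normal_path_def)
qed

lemma additive_product:
  assumes "additive m f D" "normal_path m L" "is_diagram V" "thin V" "top_word V = length L"
  shows "f (bottom_path (mk m L \<odot> V)) = f L +
    (\<Sum>c\<in>cells V. D (Src 0 \<in> set c) (Src (length L - 1) \<in> set c) (map (ev ((!) L)) c))"
proof -
  have t: "tiling (srcs (length L)) (cells V) (bottom_path V)"
    using thin_tiling[OF assms(3,4)] assms(5) by simp
  have "map (ev ((!) L)) (cell_bottom c) = flip (map (ev ((!) L)) c)" if "c \<in> cells V" for c
    using map_ev_cell_bottom_srcs[OF assms(2)] tiling_cells[OF t that] by blast
  then show ?thesis
    using additive_tiling[OF t assms(1), of "[]" "[]" "ev ((!) L)"] assms(2) normal_path_ne[OF assms(2)]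
      product_normal(1)[OF assms(2,3,5)]
    by (simp add: map_ev_srcs hd_srcs last_srcs del: srcs_simps(1))
qed

section \<open>Affine extension of functions on vertices\<close>

definition lin :: "(diagram \<Rightarrow> real) \<Rightarrow> point \<Rightarrow> real" where
  "lin f y = (\<Sum>W | y W \<noteq> 0. y W * f W)"

lemma finite_prefixes: "is_diagram \<Phi> \<Longrightarrow> thin \<Phi> \<Longrightarrow> finite {V. is_prefix V \<Phi>}"
  using bij_betw_finite[OF prefixes_bij] finite_cellsof by (simp add: is_diagram_cells)

lemma finite_cells: "is_diagram \<Phi> \<Longrightarrow> finite (cells \<Phi>)"
  by (simp add: is_diagram_cells finite_cellsof)

lemma cube_point_weight:
  "cube_point U \<Phi> t W = (\<Sum>V | is_prefix V \<Phi> \<and> U \<odot> V = W. weight t (cells \<Phi>) (cells V))"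
  by (simp add: cube_point_def weight_def)

lemma lin_cube_point:
  assumes "is_diagram \<Phi>" "thin \<Phi>"
  shows "lin f (cube_point U \<Phi> t) = (\<Sum>V | is_prefix V \<Phi>. weight t (cells \<Phi>) (cells V) * f (U \<odot> V))"
proof -
  let ?P = "{V. is_prefix V \<Phi>}" and ?y = "cube_point U \<Phi> t" and ?w = "\<lambda>V. weight t (cells \<Phi>) (cells V)"
  have P: "finite ?P"
    by (rule finite_prefixes[OF assms])
  have y: "?y W * f W = (\<Sum>V\<in>{V\<in>?P. U \<odot> V = W}. ?w V * f (U \<odot> V))" for W
    unfolding cube_point_weight sum_distrib_right by (rule sum.cong) auto
  have "{W. ?y W \<noteq> 0} \<subseteq> (\<lambda>V. U \<odot> V) ` ?P"
  proof
    fix W assume "W \<in> {W. ?y W \<noteq> 0}"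
    then have "{V. is_prefix V \<Phi> \<and> U \<odot> V = W} \<noteq> {}"
      unfolding cube_point_weight by force
    then show "W \<in> (\<lambda>V. U \<odot> V) ` ?P"
      by blast
  qed
  then have "lin f ?y = (\<Sum>W\<in>(\<lambda>V. U \<odot> V) ` ?P. ?y W * f W)"
    unfolding lin_def using P by (intro sum.mono_neutral_left) auto
  also have "\<dots> = (\<Sum>V\<in>?P. ?w V * f (U \<odot> V))"
    unfolding y by (rule sum.group) (use P in auto)
  finally show ?thesis by simp
qed

text \<open>At the corner belonging to a prefix \<open>V\<close> an additive function is
  \<open>f L\<close> plus one increment for each cell of \<open>V\<close>, so interpolation gives an
  affine function of the coordinates.\<close>

lemma lin_additive:
  assumes "additive m f D" "normal_path m L" "is_cube m (mk m L) \<Phi>"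
  shows "lin (\<lambda>W. f (bottom_path W)) (cube_point (mk m L) \<Phi> t) = f L +
    (\<Sum>c\<in>cells \<Phi>. t c * D (Src 0 \<in> set c) (Src (length L - 1) \<in> set c) (map (ev ((!) L)) c))"
proof -
  let ?d = "\<lambda>c. D (Src 0 \<in> set c) (Src (length L - 1) \<in> set c) (map (ev ((!) L)) c)"
  have \<Phi>: "is_diagram \<Phi>" "thin \<Phi>" "top_word \<Phi> = length L"
    using assms(3) by (auto simp: is_cube_def)
  have "lin (\<lambda>W. f (bottom_path W)) (cube_point (mk m L) \<Phi> t) =
    (\<Sum>V | is_prefix V \<Phi>. weight t (cells \<Phi>) (cells V) * (f L + (\<Sum>c\<in>cells V. ?d c)))"
    unfolding lin_cube_point[OF \<Phi>(1,2)]
  proof (intro sum.cong HOL.refl, goal_cases)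
    case (1 V)
    then have "is_diagram V" "thin V" "top_word V = length L"
      using is_prefixD thin_prefix[OF \<Phi>(2)] \<Phi>(3) by auto
    then show ?case
      using additive_product[OF assms(1,2)] by simp
  qed
  also have "\<dots> = (\<Sum>C\<in>Pow (cells \<Phi>). weight t (cells \<Phi>) C * (f L + (\<Sum>c\<in>C. ?d c)))"
    using sum.reindex_bij_betw[OF prefixes_bij[OF \<Phi>(1,2)]] by fast
  finally show ?thesis
    using sum_weight_sum[OF finite_cells[OF \<Phi>(1)]] by simp
qed

lemma sum_prefix_weight:
  assumes "is_diagram \<Phi>" "thin \<Phi>"
  shows "(\<Sum>V | is_prefix V \<Phi>. weight t (cells \<Phi>) (cells V)) = 1"
  using sum.reindex_bij_betw[OF prefixes_bij[OF assms], of "weight t (cells \<Phi>)"]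
    sum_weight[OF finite_cells[OF assms(1)]] by simp

section \<open>Associativity and the group action\<close>

lemma ev_cong: "well_formed n e \<Longrightarrow> (\<And>i. i < n \<Longrightarrow> \<sigma> i = \<tau> i) \<Longrightarrow> ev \<sigma> e = ev \<tau> e"
proof (induction e)
  case (Out p j)
  then have "map (ev \<sigma>) p = map (ev \<tau>) p"
    by simp
  then show ?case by (simp only: ev.simps)
qed simp

lemma vertexE:
  assumes "U \<in> vertices m"
  obtains L where "U = mk m L" "normal_path m L"
  using assms vertices_eq by auto

lemma vertex_mk: "normal_path m L \<Longrightarrow> mk m L \<in> vertices m"
  using vertices_eq by auto

lemma diagram_groupE:
  assumes "h \<in> diagram_group m"
  obtains H where "h = mk m H" "normal_path m H" "length H = m"
proof -
  have "h \<in> vertices m"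
    using assms by (auto simp: diagram_group_def vertices_def)
  then obtain H where "h = mk m H" "normal_path m H"
    by (rule vertexE)
  then show ?thesis
    using that assms by (auto simp: diagram_group_def)
qed

lemma product_vertex:
  assumes "U \<in> vertices m" "is_diagram V" "top_word V = bot_word U"
  shows "U \<odot> V \<in> vertices m" "bot_word (U \<odot> V) = bot_word V"
proof -
  obtain L where L: "U = mk m L" "normal_path m L"
    using assms(1) by (rule vertexE)
  then show "U \<odot> V \<in> vertices m" "bot_word (U \<odot> V) = bot_word V"
    using product_normal[OF L(2) assms(2)] assms(3) by (auto intro: vertex_mk simp: bot_word_def)
qed

lemma product_assoc:
  assumes "h \<in> diagram_group m" "U \<in> vertices m" "is_diagram V" "top_word V = bot_word U"
  shows "h \<odot> (U \<odot> V) = (h \<odot> U) \<odot> V"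
proof -
  obtain H where H: "h = mk m H" "normal_path m H" "length H = m"
    using assms(1) by (rule diagram_groupE)
  obtain L where L: "U = mk m L" "normal_path m L"
    using assms(2) by (rule vertexE)
  let ?L = "map (ev ((!) H)) L" and ?K = "bottom_path V"
  have V: "top_word V = length L"
    using assms(4) L by simp
  have LU: "is_diagram (mk m L')" "top_word (mk m L') = length H" if "normal_path m L'" for L'
    using that H(3) by (auto simp: normal_path_def)
  note UV = product_normal[OF L(2) assms(3) V]
  note hU = product_normal[OF H(2) LU[OF L(2)], unfolded mk_simps]
  note hUV = product_normal[OF H(2) LU[OF UV(2)], unfolded mk_simps]
  have V': "top_word V = length ?L"
    using V by simp
  note hUV2 = product_normal[OF hU(2) assms(3) V']
  have "ev ((!) H) (ev ((!) L) e) = ev ((!) ?L) e" if "e \<in> set ?K" for e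
  proof -
    have e: "well_formed (length L) e"
      using path_well_formed is_diagram_imp[OF assms(3)] that V by metis
    have "ev ((!) H) (ev ((!) L) e) = ev (\<lambda>i. ev ((!) H) (L ! i)) e"
      by (rule ev_ev[OF _ _ e, of m _ m]) (use normal_nth[OF L(2)] normal_nth[OF H(2)] H(3) in auto)
    also have "\<dots> = ev ((!) ?L) e"
      by (rule ev_cong[OF e]) simp
    finally show ?thesis .
  qed
  then have "map (ev ((!) H)) (map (ev ((!) L)) ?K) = map (ev ((!) ?L)) ?K"
    by simp
  then show ?thesis
    unfolding H(1) L(1) UV(1) hU(1) hUV(1) hUV2(1) by (rule arg_cong)
qed

lemma is_cube_translate:
  assumes "h \<in> diagram_group m" "is_cube m U \<Phi>"
  shows "is_cube m (h \<odot> U) \<Phi>"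
proof -
  have "h \<in> vertices m" "bot_word h = m" "is_diagram U" "top_word U = m"
    using assms by (auto simp: diagram_group_def vertices_def is_cube_def)
  then show ?thesis
    using product_vertex[of h m U] assms(2) by (auto simp: is_cube_def)
qed

lemma act_eq_lin: "act h y W = lin (\<lambda>U. of_bool (h \<odot> U = W)) y" if "finite {U. y U \<noteq> 0}"
  unfolding act_def lin_def by (rule sum.mono_neutral_cong_left) (use that in auto)

lemma finite_support_cube_point:
  assumes "is_diagram \<Phi>" "thin \<Phi>"
  shows "finite {W. cube_point U \<Phi> t W \<noteq> 0}"
proof (rule finite_subset)
  show "{W. cube_point U \<Phi> t W \<noteq> 0} \<subseteq> (\<lambda>V. U \<odot> V) ` {V. is_prefix V \<Phi>}"
  proof
    fix W assume "W \<in> {W. cube_point U \<Phi> t W \<noteq> 0}"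
    then have "{V. is_prefix V \<Phi> \<and> U \<odot> V = W} \<noteq> {}"
      unfolding cube_point_weight by force
    then show "W \<in> (\<lambda>V. U \<odot> V) ` {V. is_prefix V \<Phi>}"
      by blast
  qed
qed (simp add: finite_prefixes[OF assms])

text \<open>By associativity the corner of a prefix \<open>V\<close> in the cube at \<open>U\<close>
  goes to the corner of the same prefix in the cube at \<open>h \<odot> U\<close>.\<close>

lemma act_cube_point:
  assumes "h \<in> diagram_group m" "is_cube m U \<Phi>"
  shows "act h (cube_point U \<Phi> t) = cube_point (h \<odot> U) \<Phi> t"
proof
  fix W
  have \<Phi>: "is_diagram \<Phi>" "thin \<Phi>" "top_word \<Phi> = bot_word U" "U \<in> vertices m"
    using assms by (auto simp: is_cube_def)
  have "act h (cube_point U \<Phi> t) W =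
      (\<Sum>V | is_prefix V \<Phi>. weight t (cells \<Phi>) (cells V) * of_bool (h \<odot> (U \<odot> V) = W))"
    by (simp add: act_eq_lin finite_support_cube_point \<Phi> lin_cube_point)
  also have "\<dots> = (\<Sum>V | is_prefix V \<Phi> \<and> (h \<odot> U) \<odot> V = W. weight t (cells \<Phi>) (cells V))"
  proof (rule sum.mono_neutral_cong_right)
    show "\<forall>V\<in>{V. is_prefix V \<Phi>} - {V. is_prefix V \<Phi> \<and> h \<odot> U \<odot> V = W}.
      weight t (cells \<Phi>) (cells V) * of_bool (h \<odot> (U \<odot> V) = W) = 0"
      using product_assoc[OF assms(1) \<Phi>(4)] is_prefixD \<Phi>(3) by auto
    show "weight t (cells \<Phi>) (cells V) * of_bool (h \<odot> (U \<odot> V) = W) = weight t (cells \<Phi>) (cells V)"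
      if "V \<in> {V. is_prefix V \<Phi> \<and> h \<odot> U \<odot> V = W}" for V
      using that product_assoc[OF assms(1) \<Phi>(4)] is_prefixD \<Phi>(3) by auto
  qed (use finite_prefixes[OF \<Phi>(1,2)] in auto)
  finally show "act h (cube_point U \<Phi> t) W = cube_point (h \<odot> U) \<Phi> t W"
    by (simp add: cube_point_weight)
qed

lemma lin_act:
  assumes "h \<in> diagram_group m" "y \<in> cube_complex m"
  shows "lin f (act h y) = lin (\<lambda>U. f (h \<odot> U)) y"
proof -
  obtain U \<Phi> t where y: "y = cube_point U \<Phi> t" "is_cube m U \<Phi>"
    using assms(2) by (auto simp: cube_complex_def)
  have \<Phi>: "is_diagram \<Phi>" "thin \<Phi>" "top_word \<Phi> = bot_word U" "U \<in> vertices m"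
    using y by (auto simp: is_cube_def)
  show ?thesis
    unfolding y(1) act_cube_point[OF assms(1) y(2)] lin_cube_point[OF \<Phi>(1,2)]
    using product_assoc[OF assms(1) \<Phi>(4)] is_prefixD \<Phi>(3) by (intro sum.cong) auto
qed

text \<open>The weights of a point add up to 1, so a constant difference on the vertices carries
  over to all points.\<close>

lemma lin_cong:
  assumes "y \<in> cube_complex m" "\<And>U. U \<in> vertices m \<Longrightarrow> f U = g U + k"
  shows "lin f y = lin g y + k"
proof -
  obtain U \<Phi> t where y: "y = cube_point U \<Phi> t" "is_cube m U \<Phi>"
    using assms(1) by (auto simp: cube_complex_def)
  have \<Phi>: "is_diagram \<Phi>" "thin \<Phi>" "top_word \<Phi> = bot_word U" "U \<in> vertices m"
    using y by (auto simp: is_cube_def)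
  let ?w = "\<lambda>V. weight t (cells \<Phi>) (cells V)"
  have "f (U \<odot> V) = g (U \<odot> V) + k" if "is_prefix V \<Phi>" for V
    using assms(2) product_vertex(1)[OF \<Phi>(4)] is_prefixD[OF that] \<Phi>(3) by simp
  then have "(\<Sum>V | is_prefix V \<Phi>. ?w V * f (U \<odot> V)) = (\<Sum>V | is_prefix V \<Phi>. ?w V * g (U \<odot> V) + ?w V * k)"
    by (intro sum.cong) (auto simp: algebra_simps)
  then show ?thesis
    unfolding y(1) lin_cube_point[OF \<Phi>(1,2)]
    by (simp add: sum.distrib flip: sum_distrib_right) (simp add: sum_prefix_weight[OF \<Phi>(1,2)])
qed

lemma weight_corner:
  assumes "finite A" "C \<subseteq> A" "C0 \<subseteq> A"
  shows "weight (\<lambda>c. of_bool (c \<in> C0)) A C = of_bool (C = C0)"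
proof (cases "C = C0")
  case True
  then show ?thesis by (auto simp: weight_def)
next
  case False
  have "finite C"
    using assms finite_subset by blast
  then show ?thesis
    using False assms by (auto simp: weight_def prod_zero_iff)
qed

lemma cube_point_corner:
  assumes "is_diagram \<Phi>" "thin \<Phi>" "is_prefix V0 \<Phi>"
  shows "cube_point U \<Phi> (\<lambda>c. of_bool (c \<in> cells V0)) = vertex_point (U \<odot> V0)"
proof
  fix W
  have w: "weight (\<lambda>c. of_bool (c \<in> cells V0)) (cells \<Phi>) (cells V) = of_bool (V = V0)" if "is_prefix V \<Phi>" for V
    using weight_corner[OF finite_cells[OF assms(1)], of "cells V" "cells V0"] is_prefixD[OF that]
      is_prefixD[OF assms(3)] bij_betw_imp_inj_on[OF prefixes_bij[OF assms(1,2)]] that assms(3)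
    by (auto simp: inj_on_eq_iff)
  have fin: "finite {V. is_prefix V \<Phi> \<and> U \<odot> V = W}"
    by (rule finite_subset[OF _ finite_prefixes[OF assms(1,2)]]) auto
  have "cube_point U \<Phi> (\<lambda>c. of_bool (c \<in> cells V0)) W = (\<Sum>V | is_prefix V \<Phi> \<and> U \<odot> V = W. of_bool (V = V0))"
    unfolding cube_point_weight by (rule sum.cong) (auto simp: w)
  also have "\<dots> = of_bool (U \<odot> V0 = W)"
    using fin assms(3) by (simp add: of_bool_def)
  finally show "cube_point U \<Phi> (\<lambda>c. of_bool (c \<in> cells V0)) W = vertex_point (U \<odot> V0) W"
    by (auto simp: vertex_point_def)
qed

section \<open>Crossing numbers and depths\<close>

text \<open>Translation by \<open>H\<close> commutes with \<open>flip\<close>, so \<open>f\<close>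
  and the translated \<open>f'\<close> change by the same amount under every flip and differ by a
  constant. It is found at the degenerate path, which is moved to \<open>H\<close>.\<close>

lemma additive_translate:
  assumes H: "normal_path m H" "length H = m"
    and f: "additive m f D" and f': "additive m f' D'"
    and D: "\<And>l r q. normal_top m q \<Longrightarrow> D' l r (map (ev ((!) H)) q) = D l r q"
    and L: "normal_path m L"
  shows "f' (map (ev ((!) H)) L) = f L + (f' H - f (srcs m))"
  using L
proof (induction rule: normal_path_induct)
  case base
  then show ?case using map_ev_srcs[of H] H(2) by simp
next
  case (flip X q Y)
  let ?\<sigma> = "ev ((!) H)"
  have q: "normal_top m q"
    using normal_path_flip(1)[OF flip(1,2)] .
  have fl: "map ?\<sigma> (flip q) = flip (map ?\<sigma> q)"
    by (rule map_ev_flip[OF _ q, of m]) (use H normal_nth in auto)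
  have "is_diagram (mk m (X @ q @ Y))"
    using flip(1) by (simp add: normal_path_def)
  then have "normal_path m (map ?\<sigma> X @ map ?\<sigma> q @ map ?\<sigma> Y)"
    using product_normal(2)[OF H(1), of "mk m (X @ q @ Y)"] H(2) by simp
  from additiveD[OF f' this] have
    "f' (map ?\<sigma> X @ flip (map ?\<sigma> q) @ map ?\<sigma> Y) = f' (map ?\<sigma> (X @ q @ Y)) + D (X = []) (Y = []) q"
    using flip(2) D[OF q] by simp
  then show ?case
    using additiveD[OF f flip(1,2)] flip(4) fl by simp
qed

text \<open>A cell \<open>p\<close> and its inverse \<open>flip p\<close> name the two sides of one
  hyperplane. For normal \<open>p\<close>, only the one that is no cell bottom can occur in a
  reduced diagram, and the sign tells from which side \<open>p\<close> views the hyperplane.\<close>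

definition crossing :: "cell \<Rightarrow> edge list \<Rightarrow> real" where
  "crossing p L = of_bool (p \<in> cellsof L) - of_bool (flip p \<in> cellsof L)"

definition sign_at :: "cell \<Rightarrow> cell \<Rightarrow> real" where
  "sign_at p q = of_bool (q = p) - of_bool (q = flip p)"

lemma crossing_srcs [simp]: "crossing p (srcs m) = 0"
  by (simp add: crossing_def srcs_def)

text \<open>A flip adds the cell \<open>q\<close> or removes the cell \<open>flip q\<close>, and
  \<open>path_top_not_cell\<close> ensures that this cell is absent from the smaller of the two
  diagrams.\<close>

lemma additive_crossing:
  assumes p: "normal_top m p"
  shows "additive m (crossing p) (\<lambda>_ _. sign_at p)"
  unfolding additive_def
proof (intro allI impI)
  fix X q Y assume L: "normal_path m (X @ q @ Y)" and q: "valid q"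
  have n: "normal_top m q"
    by (rule normal_path_flip(1)[OF L q])
  have path: "path m (X @ q @ Y)" "path m (X @ flip q @ Y)"
    using L normal_path_flip(2)[OF L q] by (auto simp: normal_path_def)
  from n show "crossing p (X @ flip q @ Y) = crossing p (X @ q @ Y) + sign_at p q"
  proof (cases rule: normal_top_cases)
    case top
    have "q \<notin> cellsof (X @ q @ Y)"
      by (rule path_top_not_cell[OF path(1) q])
    moreover have "cellsof (X @ flip q @ Y) = insert q (cellsof (X @ q @ Y))"
      using top by auto
    ultimately show ?thesis
      unfolding crossing_def sign_at_def by auto
  next
    case (bottom c)
    have "c \<notin> cellsof (X @ c @ Y)"
      using path_top_not_cell[of m X c Y] path(2) bottom normal_topD(1) by auto
    moreover have "cellsof (X @ q @ Y) = insert c (cellsof (X @ c @ Y))"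
      using bottom by auto
    moreover have "flip q = c"
      using bottom by simp
    moreover from this have "q = p \<longleftrightarrow> c = flip p" "q = flip p \<longleftrightarrow> c = p"
      using flip_normal_top(1)[OF n] flip_normal_top(1)[OF p] by metis+
    ultimately show ?thesis
      unfolding crossing_def sign_at_def by auto
  qed
qed

text \<open>
  The depths are meaningful only for the first and the last edge of a bottom path: on other edges they are
  not compatible with the reduction.
\<close>

primrec left_depth :: "edge \<Rightarrow> real" where
  "left_depth (Src i) = 0"
| "left_depth (Out p j) = hd (map left_depth p) + (if length p = 1 then 1 else - 1)"

primrec right_depth :: "edge \<Rightarrow> real" where
  "right_depth (Src i) = 0"
| "right_depth (Out p j) = last (map right_depth p) + (if length p = 1 then 1 else - 1)"

definition skew :: "edge list \<Rightarrow> real" where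
  "skew L = left_depth (hd L) - right_depth (last L)"

text \<open>A cell along the whole path touches both ends, and its two contributions cancel.\<close>

definition skew_step :: "bool \<Rightarrow> bool \<Rightarrow> cell \<Rightarrow> real" where
  "skew_step l r q = (of_bool l - of_bool r) * (if length q = 1 then 1 else - 1)"

text \<open>Flipping exchanges the lengths 1 and 2 and thus the increments 1 and -1, so the rule for
  adding a cell is also right for removing one.\<close>

lemma depth_flip:
  assumes "normal_top m q"
  shows "left_depth (hd (flip q)) = left_depth (hd q) + (if length q = 1 then 1 else - 1)"
    "right_depth (last (flip q)) = right_depth (last q) + (if length q = 1 then 1 else - 1)"
proof -
  have *: "left_depth (hd (cell_bottom c)) = left_depth (hd c) + (if length c = 1 then 1 else - 1)"
    "right_depth (last (cell_bottom c)) = right_depth (last c) + (if length c = 1 then 1 else - 1)"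
    if "valid c" for c
    using that by (auto elim!: valid_cases)
  from assms have "left_depth (hd (flip q)) = left_depth (hd q) + (if length q = 1 then 1 else - 1) \<and>
    right_depth (last (flip q)) = right_depth (last q) + (if length q = 1 then 1 else - 1)"
  proof (cases rule: normal_top_cases)
    case top
    then show ?thesis
      using *[OF normal_topD(1)[OF assms]] by simp
  next
    case (bottom c)
    then have "valid c"
      using normal_topD(1) by blast
    then show ?thesis
      using *[of c] bottom length_cell_bottom[of c] by (auto simp: valid_def)
  qed
  then show "left_depth (hd (flip q)) = left_depth (hd q) + (if length q = 1 then 1 else - 1)"
    "right_depth (last (flip q)) = right_depth (last q) + (if length q = 1 then 1 else - 1)"
    by auto
qed

lemma additive_skew: "additive m skew skew_step"
  unfolding additive_def
proof (intro allI impI)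
  fix X q Y assume L: "normal_path m (X @ q @ Y)" and q: "valid q"
  have n: "normal_top m q"
    by (rule normal_path_flip(1)[OF L q])
  have ne: "q \<noteq> []" "flip q \<noteq> []"
    using q normal_topD(1)[OF flip_normal_top(2)[OF n]] by auto
  have "left_depth (hd (X @ flip q @ Y)) = left_depth (hd (X @ q @ Y)) +
      of_bool (X = []) * (if length q = 1 then 1 else - 1)"
    using depth_flip[OF n] ne by (cases X) auto
  moreover have "right_depth (last (X @ flip q @ Y)) = right_depth (last (X @ q @ Y)) +
      of_bool (Y = []) * (if length q = 1 then 1 else - 1)"
    using depth_flip[OF n] ne by (cases "Y = []") auto
  ultimately show "skew (X @ flip q @ Y) = skew (X @ q @ Y) + skew_step (X = []) (Y = []) q"
    unfolding skew_def skew_step_def by (simp only: left_diff_distrib)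
qed

section \<open>Edges at the two ends of a bottom path\<close>

primrec leftmost :: "edge \<Rightarrow> bool" where
  "leftmost (Src i) \<longleftrightarrow> i = 0"
| "leftmost (Out p j) \<longleftrightarrow> j = 0 \<and> hd (map leftmost p)"

text \<open>The index \<open>2 - length p\<close> is that of the last bottom edge: 1 below an upper
  cell, 0 below a lower one.\<close>

primrec rightmost :: "nat \<Rightarrow> edge \<Rightarrow> bool" where
  "rightmost m (Src i) \<longleftrightarrow> Suc i = m"
| "rightmost m (Out p j) \<longleftrightarrow> j = 2 - length p \<and> last (map (rightmost m) p)"

lemma extremal_flip:
  assumes "normal_top m q"
  shows "leftmost (hd (flip q)) = leftmost (hd q)" "rightmost m (last (flip q)) = rightmost m (last q)"
proof -
  have *: "leftmost (hd (cell_bottom c)) = leftmost (hd c)"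
    "rightmost m (last (cell_bottom c)) = rightmost m (last c)" if "valid c" for c
    using that by (auto elim!: valid_cases)
  from assms have "leftmost (hd (flip q)) = leftmost (hd q) \<and> rightmost m (last (flip q)) = rightmost m (last q)"
  proof (cases rule: normal_top_cases)
    case top
    then show ?thesis
      using *[OF normal_topD(1)[OF assms]] by simp
  next
    case (bottom c)
    then show ?thesis
      using *[OF normal_topD(1)[OF bottom(2)]] by simp
  qed
  then show "leftmost (hd (flip q)) = leftmost (hd q)" "rightmost m (last (flip q)) = rightmost m (last q)"
    by auto
qed

lemma path_ends: "normal_path m L \<Longrightarrow> leftmost (hd L) \<and> rightmost m (last L)"
proof -
  assume L: "normal_path m L"
  have "path m L"
    using L by (simp add: normal_path_def)
  then have "m > 0"
    by (induction rule: path.induct) auto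
  from L show ?thesis
  proof (induction rule: normal_path_induct)
    case base
    then show ?case using \<open>m > 0\<close> by (simp add: hd_srcs last_srcs)
  next
    case (flip X q Y)
    have n: "normal_top m q"
      by (rule normal_path_flip(1)[OF flip(1,2)])
    have ne: "q \<noteq> []" "flip q \<noteq> []"
      using flip(2) normal_topD(1)[OF flip_normal_top(2)[OF n]] by auto
    have "leftmost (hd (X @ flip q @ Y)) = leftmost (hd (X @ q @ Y))"
      using extremal_flip[OF n] ne by (cases X) auto
    moreover have "rightmost m (last (X @ flip q @ Y)) = rightmost m (last (X @ q @ Y))"
      using extremal_flip[OF n] ne by (cases "Y = []") auto
    ultimately show ?case
      using flip(4) by blast
  qed
qed

lemma tiling_segment: "tiling T C B \<Longrightarrow> c \<in> C \<Longrightarrow> \<exists>P Q. T = P @ c @ Q"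
proof (induction rule: tiling.induct)
  case (skip T C B a)
  then show ?case by (metis append_Cons)
next
  case (cell T C B d)
  then show ?case by (metis append.left_neutral append.assoc insertE)
qed simp

lemma tiling_disjoint:
  assumes "tiling T C B" "distinct T" "c \<in> C" "d \<in> C" "set c \<inter> set d \<noteq> {}"
  shows "c = d"
  using assms
proof (induction rule: tiling.induct)
  case (cell T C B e)
  have "set c \<subseteq> set T" if "c \<in> C" for c
    using tiling_cells[OF cell.hyps(1) that] by blast
  then show ?case
    using cell by (cases "c = e"; cases "d = e"; fastforce)
qed auto

text \<open>One of \<open>q\<close> and \<open>flip q\<close> is the bottom of the other, and once
  an edge of the bottom of a cell is on the path, the top edges of this cell have left it.\<close>

lemma no_flip_on_path:
  assumes "normal_path m L" "normal_top m q" "set q \<subseteq> set L"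
  shows "\<not> set (flip q) \<subseteq> set L"
proof
  assume f: "set (flip q) \<subseteq> set L"
  have *: False if "valid c" "set c \<subseteq> set L" "set (cell_bottom c) \<subseteq> set L" for c
  proof -
    have "Out c 0 \<in> set L"
      using that(3) by (auto simp: cell_bottom_def split: if_splits)
    then have "set c \<inter> set L = {}"
      using path_planar assms(1) Out_mem_cellsof unfolding normal_path_def by blast
    then show False
      using that by (cases c) auto
  qed
  from assms(2) show False
  proof (cases rule: normal_top_cases)
    case top
    then show ?thesis
      using *[OF normal_topD(1)[OF assms(2)] assms(3)] f by simp
  next
    case (bottom c)
    then show ?thesis
      using *[OF normal_topD(1)[OF bottom(2)]] assms(3) f by simp
  qed
qed

text \<open>There are at most two elements with \<open>\<kappa> c \<noteq> 0\<close>, so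
  Cauchy-Schwarz costs a factor 2, which the division by 2 makes up for. On the remaining elements
  the matrix \<open>\<delta>\<close> has at most one nonzero entry in each row and column, so it
  does not increase the norm.\<close>

lemma orthogonal_coordinates:
  fixes u \<kappa> :: "'a \<Rightarrow> real" and \<delta> :: "'i \<Rightarrow> 'a \<Rightarrow> real"
  assumes fin: "finite A" "finite N"
    and row: "\<And>i c d. c \<in> A \<Longrightarrow> d \<in> A \<Longrightarrow> \<delta> i c \<noteq> 0 \<Longrightarrow> \<delta> i d \<noteq> 0 \<Longrightarrow> c = d"
    and col: "\<And>i j c. \<delta> i c \<noteq> 0 \<Longrightarrow> \<delta> j c \<noteq> 0 \<Longrightarrow> i = j"
    and bounds: "\<And>i c. \<bar>\<delta> i c\<bar> \<le> 1" "\<And>c. \<bar>\<kappa> c\<bar> \<le> 1"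
    and sep: "\<And>i c. c \<in> A \<Longrightarrow> \<kappa> c \<noteq> 0 \<Longrightarrow> \<delta> i c = 0"
    and card: "card {c \<in> A. \<kappa> c \<noteq> 0} \<le> 2"
  shows "(\<Sum>c\<in>A. u c * \<kappa> c)\<^sup>2 / 2 + (\<Sum>i\<in>N. (\<Sum>c\<in>A. u c * \<delta> i c)\<^sup>2) \<le> (\<Sum>c\<in>A. (u c)\<^sup>2)"
proof -
  let ?E = "{c \<in> A. \<kappa> c \<noteq> 0}"
  have sq1: "x\<^sup>2 \<le> 1" if "\<bar>x\<bar> \<le> 1" for x :: real
    using that by (simp add: abs_square_le_1)
  have le: "(u c * x)\<^sup>2 \<le> (u c)\<^sup>2" if "\<bar>x\<bar> \<le> 1" for c x
    using mult_left_mono[OF sq1[OF that], of "(u c)\<^sup>2"] by (simp add: power_mult_distrib)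
  have "(\<Sum>c\<in>A. u c * \<kappa> c) = (\<Sum>c\<in>?E. u c * \<kappa> c)"
    using fin by (intro sum.mono_neutral_right) auto
  then have "(\<Sum>c\<in>A. u c * \<kappa> c)\<^sup>2 \<le> (\<Sum>c\<in>?E. (u c * \<kappa> c)\<^sup>2) * card ?E"
    using sum_squared_le_sum_of_squares[of "\<lambda>c. u c * \<kappa> c" ?E] fin by simp
  also have "\<dots> \<le> (\<Sum>c\<in>?E. (u c)\<^sup>2) * 2"
    using card le bounds(2) by (intro mult_mono sum_mono) (auto intro!: sum_nonneg)
  finally have 1: "(\<Sum>c\<in>A. u c * \<kappa> c)\<^sup>2 / 2 \<le> (\<Sum>c\<in>?E. (u c)\<^sup>2)"
    by simp
  have "(\<Sum>c\<in>A. u c * \<delta> i c)\<^sup>2 = (\<Sum>c\<in>A. (u c)\<^sup>2 * (\<delta> i c)\<^sup>2)" for i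
  proof (cases "\<exists>c\<in>A. \<delta> i c \<noteq> 0")
    case True
    then obtain c0 where c0: "c0 \<in> A" "\<delta> i c0 \<noteq> 0" by auto
    have z: "\<delta> i c = 0" if "c \<in> A - {c0}" for c
      using row[of c c0 i] that c0 by auto
    have "(\<Sum>c\<in>A. u c * \<delta> i c) = u c0 * \<delta> i c0" "(\<Sum>c\<in>A. (u c)\<^sup>2 * (\<delta> i c)\<^sup>2) = (u c0)\<^sup>2 * (\<delta> i c0)\<^sup>2"
      using z by (simp_all add: sum.remove[OF fin(1) c0(1)])
    then show ?thesis by (simp add: power_mult_distrib)
  qed simp
  then have "(\<Sum>i\<in>N. (\<Sum>c\<in>A. u c * \<delta> i c)\<^sup>2) = (\<Sum>c\<in>A. (u c)\<^sup>2 * (\<Sum>i\<in>N. (\<delta> i c)\<^sup>2))"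
    by (simp add: sum_distrib_left) (rule sum.swap)
  also have "\<dots> \<le> (\<Sum>c\<in>A. (u c)\<^sup>2 * of_bool (\<kappa> c = 0))"
  proof (intro sum_mono mult_left_mono)
    fix c assume c: "c \<in> A"
    show "(\<Sum>i\<in>N. (\<delta> i c)\<^sup>2) \<le> of_bool (\<kappa> c = 0)"
    proof (cases "\<exists>i\<in>N. \<delta> i c \<noteq> 0")
      case True
      then obtain i0 where i0: "i0 \<in> N" "\<delta> i0 c \<noteq> 0" by auto
      have "\<delta> i c = 0" if "i \<in> N - {i0}" for i
        using col[of i c i0] that i0 by auto
      then have "(\<Sum>i\<in>N. (\<delta> i c)\<^sup>2) = (\<delta> i0 c)\<^sup>2"
        by (simp add: sum.remove[OF fin(2) i0(1)])
      then show ?thesis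
        using sep[OF c, of i0] i0 sq1[OF bounds(1)] by auto
    qed auto
  qed auto
  also have "\<dots> = (\<Sum>c\<in>A - ?E. (u c)\<^sup>2)"
    using fin by (intro sum.mono_neutral_cong_right) auto
  finally show ?thesis
    using 1 sum.subset_diff[of ?E A "\<lambda>c. (u c)\<^sup>2"] fin by auto
qed

section \<open>The coordinates of \<open>g\<close>\<close>

abbreviation lin_path :: "(edge list \<Rightarrow> real) \<Rightarrow> point \<Rightarrow> real" where
  "lin_path f \<equiv> lin (\<lambda>W. f (bottom_path W))"

lemma sum_real_diff_mult:
  fixes s t \<delta> :: "'a \<Rightarrow> real"
  shows "(k + (\<Sum>c\<in>A. s c * \<delta> c)) - (k + (\<Sum>c\<in>A. t c * \<delta> c)) = (\<Sum>c\<in>A. (s c - t c) * \<delta> c)"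
  by (simp add: left_diff_distrib sum_subtractf)

text \<open>On a cube the coordinates are affine, and the increments of the cells satisfy the
  assumptions of \<open>orthogonal_coordinates\<close>: the hyperplanes of the \<open>w i\<close>
  are crossed away from the ends of the path, where \<open>skew\<close> changes.\<close>

lemma cube_estimate:
  fixes w :: "'i \<Rightarrow> edge"
  assumes cube: "is_cube m U \<Phi>" and N: "finite N"
    and w: "inj w" "\<And>i. normal m (w i)" "\<And>i. \<not> leftmost (w i)" "\<And>i. \<not> rightmost m (w i)"
  shows "(lin_path skew (cube_point U \<Phi> s) - lin_path skew (cube_point U \<Phi> t))\<^sup>2 / 2 +
    (\<Sum>i\<in>N. (lin_path (crossing [w i]) (cube_point U \<Phi> s) - lin_path (crossing [w i]) (cube_point U \<Phi> t))\<^sup>2)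
    \<le> (\<Sum>c\<in>cells \<Phi>. (s c - t c)\<^sup>2)"
proof -
  obtain L where U: "U = mk m L" and L: "normal_path m L"
    using cube vertexE unfolding is_cube_def by blast
  let ?n = "length L" and ?q = "map (ev ((!) L))"
  let ?\<kappa> = "\<lambda>c. skew_step (Src 0 \<in> set c) (Src (?n - 1) \<in> set c) (?q c)"
  let ?\<delta> = "\<lambda>i c. sign_at [w i] (?q c)"
  have n: "?n > 0"
    using normal_path_ne[OF L] by simp
  have \<Phi>: "is_diagram \<Phi>" "thin \<Phi>" "top_word \<Phi> = ?n"
    using cube U by (auto simp: is_cube_def)
  have til: "tiling (srcs ?n) (cells \<Phi>) (bottom_path \<Phi>)"
    using thin_tiling[OF \<Phi>(1,2)] \<Phi>(3) by simp
  have wt: "normal_top m [w i]" for i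
    using w(2) by (simp add: normal_top_def)
  have len: "length (flip [w i]) = 2" for i
    using flip_normal_top(3)[OF wt] by simp
  have \<delta>: "?q c = [w i] \<or> ?q c = flip [w i]" if "?\<delta> i c \<noteq> 0" for i c
    using that by (auto simp: sign_at_def split: if_splits)
  have dL: "distinct L"
    using L path_planar by (auto simp: normal_path_def)
  have c: "valid c" "set c \<subseteq> set (srcs ?n)" if "c \<in> cells \<Phi>" for c
    using tiling_cells[OF til that] by auto
  have inj: "inj_on (ev ((!) L)) (set (srcs ?n))"
    using dL by (auto simp: inj_on_def nth_eq_iff_index_eq)
  have q: "set (?q c) \<subseteq> set L" if "c \<in> cells \<Phi>" for c
    using c[OF that] by auto
  \<comment> \<open>A cell of a tiling is a segment, so one that contains the first or the last
    source edge stands at that end.\<close>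
  have ends: "?q c \<noteq> [] \<and> (Src 0 \<in> set c \<longrightarrow> hd (?q c) = hd L) \<and> (Src (?n - 1) \<in> set c \<longrightarrow> last (?q c) = last L)"
    if cc: "c \<in> cells \<Phi>" for c
  proof -
    obtain P Q where PQ: "srcs ?n = P @ c @ Q"
      using tiling_segment[OF til cc] by blast
    have ne: "c \<noteq> []"
      using c(1)[OF cc] by auto
    have d: "distinct (P @ c @ Q)"
      using srcs_simps(2)[of ?n] unfolding PQ .
    have "L = map (ev ((!) L)) (srcs ?n)"
      by (simp add: map_ev_srcs)
    then have LPQ: "L = ?q P @ ?q c @ ?q Q"
      unfolding PQ by simp
    have hl: "hd (P @ c @ Q) = Src 0" "last (P @ c @ Q) = Src (?n - 1)"
      using hd_srcs[OF n] last_srcs[OF n] unfolding PQ by auto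
    have "P = []" if "Src 0 \<in> set c"
      using that d hl(1) by (cases P) auto
    moreover have "Q = []" if "Src (?n - 1) \<in> set c"
      using that d hl(2) last_in_set[of Q] by (cases "Q = []") auto
    ultimately show ?thesis
      using ne arg_cong[OF LPQ, of hd] arg_cong[OF LPQ, of last] by (auto simp: hd_map last_map)
  qed
  have "(\<Sum>c\<in>cells \<Phi>. (s c - t c) * ?\<kappa> c)\<^sup>2 / 2 + (\<Sum>i\<in>N. (\<Sum>c\<in>cells \<Phi>. (s c - t c) * ?\<delta> i c)\<^sup>2)
    \<le> (\<Sum>c\<in>cells \<Phi>. (s c - t c)\<^sup>2)"
  proof (rule orthogonal_coordinates)
    show "c = d" if "c \<in> cells \<Phi>" "d \<in> cells \<Phi>" "?\<delta> i c \<noteq> 0" "?\<delta> i d \<noteq> 0" for i c d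
    proof -
      have "normal_top m (?q e)" if "e \<in> cells \<Phi>" for e
        using c(1)[OF that] q[OF that] L by (auto simp: normal_top_def normal_path_def)
      \<comment> \<open>Two cells of a cube cannot cross one hyperplane from opposite sides, as both
        of their top paths lie on \<open>L\<close>.\<close>
      then have "?q c \<noteq> flip (?q d)" "?q d \<noteq> flip (?q c)"
        using no_flip_on_path[OF L] q[OF that(1)] q[OF that(2)] that(1,2) by metis+
      then have "?q c = ?q d"
        using \<delta>[OF that(3)] \<delta>[OF that(4)] by metis
      then show "c = d"
        using map_inj_on[of "ev ((!) L)" c d] inj_on_subset[OF inj] c(2)[OF that(1)] c(2)[OF that(2)] by blast
    qed
    show "i = j" if "?\<delta> i c \<noteq> 0" "?\<delta> j c \<noteq> 0" for i j c
    proof -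
      \<comment> \<open>The lists have lengths 1 and 2.\<close>
      have "[w i] \<noteq> flip [w j]" "[w j] \<noteq> flip [w i]"
        using len by (metis length_Cons list.size(3) numeral_2_eq_2 nat.inject zero_neq_one One_nat_def)+
      then have "[w i] = [w j] \<or> flip [w i] = flip [w j]"
        using \<delta>[OF that(1)] \<delta>[OF that(2)] by metis
      then have "[w i] = [w j]"
        using flip_normal_top(1)[OF wt] by metis
      then show "i = j"
        using w(1) by (simp add: inj_eq)
    qed
    show "?\<delta> i c = 0" if "c \<in> cells \<Phi>" "?\<kappa> c \<noteq> 0" for i c
    proof (rule ccontr)
      assume "?\<delta> i c \<noteq> 0"
      \<comment> \<open>By \<open>extremal_flip\<close> neither side of the hyperplane of
        \<open>w i\<close> can touch an end of the path.\<close>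
      from \<delta>[OF this] have "\<not> leftmost (hd (?q c)) \<and> \<not> rightmost m (last (?q c))"
        using extremal_flip[OF wt[of i]] w(3,4)[of i] by auto
      moreover have "Src 0 \<in> set c \<or> Src (?n - 1) \<in> set c"
        using that(2) by (auto simp: skew_step_def)
      ultimately show False
        using ends[OF that(1)] path_ends[OF L] by auto
    qed
    show "card {c \<in> cells \<Phi>. ?\<kappa> c \<noteq> 0} \<le> 2"
    proof -
      let ?E = "\<lambda>e. {c \<in> cells \<Phi>. e \<in> set c}"
      have fin: "finite (?E e)" for e
        using finite_cells[OF \<Phi>(1)] by simp
      have one: "card (?E e) \<le> 1" for e
      proof -
        have "c = d" if "c \<in> ?E e" "d \<in> ?E e" for c d
          using tiling_disjoint[OF til srcs_simps(2), of c d] that by auto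
        then show ?thesis
          using fin[of e] by (auto simp: card_le_Suc0_iff_eq)
      qed
      have "{c \<in> cells \<Phi>. ?\<kappa> c \<noteq> 0} \<subseteq> ?E (Src 0) \<union> ?E (Src (?n - 1))"
        by (auto simp: skew_step_def)
      then have "card {c \<in> cells \<Phi>. ?\<kappa> c \<noteq> 0} \<le> card (?E (Src 0) \<union> ?E (Src (?n - 1)))"
        using fin by (intro card_mono) auto
      also have "\<dots> \<le> card (?E (Src 0)) + card (?E (Src (?n - 1)))"
        by (rule card_Un_le)
      finally show ?thesis
        using one[of "Src 0"] one[of "Src (?n - 1)"] by linarith
    qed
  qed (use N finite_cells[OF \<Phi>(1)] in \<open>auto simp: sign_at_def skew_step_def of_bool_def\<close>)
  then show ?thesis
    unfolding U lin_additive[OF additive_skew L cube[unfolded U]]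
      lin_additive[OF additive_crossing[OF wt] L cube[unfolded U]] sum_real_diff_mult .
qed

section \<open>Names for two orbits of hyperplanes\<close>

lemma range_cell_bottom [simp]:
  "[a] \<in> range cell_bottom \<longleftrightarrow> (\<exists>c. length c \<noteq> 1 \<and> a = Out c 0)"
  "[a, b] \<in> range cell_bottom \<longleftrightarrow> (\<exists>x. a = Out [x] 0 \<and> b = Out [x] (Suc 0))"
proof -
  show "[a] \<in> range cell_bottom \<longleftrightarrow> (\<exists>c. length c \<noteq> 1 \<and> a = Out c 0)"
  proof
    assume "[a] \<in> range cell_bottom"
    then show "\<exists>c. length c \<noteq> 1 \<and> a = Out c 0"
      by (auto simp: cell_bottom_def split: if_splits)
  next
    assume "\<exists>c. length c \<noteq> 1 \<and> a = Out c 0"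
    then obtain c where "length c \<noteq> 1" "a = Out c 0"
      by blast
    then have "[a] = cell_bottom c"
      by (simp add: cell_bottom_def)
    then show "[a] \<in> range cell_bottom" by (rule range_eqI)
  qed
  show "[a, b] \<in> range cell_bottom \<longleftrightarrow> (\<exists>x. a = Out [x] 0 \<and> b = Out [x] (Suc 0))"
  proof
    assume "[a, b] \<in> range cell_bottom"
    then show "\<exists>x. a = Out [x] 0 \<and> b = Out [x] (Suc 0)"
      by (auto simp: cell_bottom_def length_Suc_conv split: if_splits)
  next
    assume "\<exists>x. a = Out [x] 0 \<and> b = Out [x] (Suc 0)"
    then obtain x where "[a, b] = cell_bottom [x]"
      by auto
    then show "[a, b] \<in> range cell_bottom" by (rule range_eqI)
  qed
qed

lemma flip_simps [simp]:
  "flip [Out [a, b] 0] = [a, b]"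
  "flip [Src i] = [Out [Src i] 0, Out [Src i] (Suc 0)]"
  "flip [Out [x] j] = [Out [Out [x] j] 0, Out [Out [x] j] (Suc 0)]"
  "flip [Out [x] 0, Out [x] (Suc 0)] = [x]"
  "flip [Src i, e] = [Out [Src i, e] 0]"
  "flip [e, Src i] = [Out [e, Src i] 0]"
  "flip [Out p (Suc j), e] = [Out [Out p (Suc j), e] 0]"
  using flip_cell_bottom[of "[a, b]"] flip_cell_bottom[of "[x]"] by (auto simp: flip_top)

text \<open>Translation by \<open>g\<close> deepens the left end and raises the right one: it takes
  \<open>lseq n\<close> to \<open>lseq (Suc n)\<close>, but \<open>rseq (Suc n)\<close> to
  \<open>rseq n\<close> (see \<open>translate_seq\<close>).\<close>

primrec lseq :: "nat \<Rightarrow> edge" where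
  "lseq 0 = Src 0"
| "lseq (Suc n) = Out [lseq n] 0"

primrec rseq :: "nat \<Rightarrow> edge" where
  "rseq 0 = Src 2"
| "rseq (Suc n) = Out [rseq n] (Suc 0)"

text \<open>Normal forms of the translates of \<open>Out [Src 0] (Suc 0)\<close> under the negative
  powers of \<open>g\<close>; \<open>upper_neg k\<close> belongs to the power
  \<open>- (k + 1)\<close>.\<close>

fun upper_neg :: "nat \<Rightarrow> edge" where
  "upper_neg 0 = Out [Src 1, Out [Out [Src 2] 0] 0] 0"
| "upper_neg (Suc k) = Out [Out [Out [rseq k] 0] (Suc 0), Out [Out [rseq (Suc k)] 0] 0] 0"

fun lower_pos :: "nat \<Rightarrow> edge" where
  "lower_pos 0 = Out [Out [Out [Src 0] (Suc 0)] (Suc 0), Src 1] 0"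
| "lower_pos (Suc k) = Out [Out [Out [lseq (Suc k)] (Suc 0)] (Suc 0), Out [Out [lseq k] (Suc 0)] 0] 0"

text \<open>
  The cell \<open>[orbit (True, 0)]\<close> is the second cell of \<open>g\<close>, and \<open>[orbit (False, 0)]\<close> is inverse to the third; the
  other terms are their translates under the powers of \<open>g\<close> (\<open>translate_orbit\<close> below).
\<close>

definition orbit :: "bool \<times> int \<Rightarrow> edge" where
  "orbit = (\<lambda>(b, n).
    if b then (if 0 \<le> n then Out [lseq (nat n)] (Suc 0) else upper_neg (nat (- n - 1)))
    else (if 0 \<le> n then lower_pos (nat n) else Out [rseq (nat (- n - 1))] 0))"

lemma orbit_simps [simp]:
  "orbit (True, int n) = Out [lseq n] (Suc 0)"
  "orbit (True, - int (Suc k)) = upper_neg k"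
  "orbit (False, int n) = lower_pos n"
  "orbit (False, - int (Suc k)) = Out [rseq k] 0"
  "orbit (True, 0) = Out [Src 0] (Suc 0)" "orbit (False, 0) = lower_pos 0"
  by (simp_all add: orbit_def)

lemma seq_form:
  "lseq n = Src 0 \<or> (\<exists>x. lseq n = Out [x] 0)" "rseq n = Src 2 \<or> (\<exists>x. rseq n = Out [x] (Suc 0))"
  by (cases n; auto)+

lemma seq_inject [simp]: "lseq i = lseq j \<longleftrightarrow> i = j" "rseq i = rseq j \<longleftrightarrow> i = j"
proof -
  show "lseq i = lseq j \<longleftrightarrow> i = j"
    by (induction i arbitrary: j; case_tac j; auto)
  show "rseq i = rseq j \<longleftrightarrow> i = j"
    by (induction i arbitrary: j; case_tac j; auto)
qed

lemma seq_normal: "normal 3 (lseq n)" "normal 3 (rseq n)"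
proof -
  have "[lseq k] \<notin> range cell_bottom" "[rseq k] \<notin> range cell_bottom" for k
    using seq_form[of k] by auto
  then show "normal 3 (lseq n)" "normal 3 (rseq n)"
    by (induction n) (simp_all del: range_cell_bottom)
qed

lemma flip_seq [simp]:
  "flip [lseq n] = [Out [lseq n] 0, Out [lseq n] (Suc 0)]"
  "flip [rseq n] = [Out [rseq n] 0, Out [rseq n] (Suc 0)]"
  by (cases n; simp)+

lemma orbit_cases:
  obtains n where "i = (True, int n)" | k where "i = (True, - int (Suc k))"
  | n where "i = (False, int n)" | k where "i = (False, - int (Suc k))"
  by (cases i; cases "fst i"; cases "snd i" rule: int_cases) (auto simp del: of_nat_Suc)

lemma upper_neg_inject [simp]: "upper_neg j = upper_neg k \<longleftrightarrow> j = k"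
  by (cases j; cases k) (auto simp del: rseq.simps)

lemma lower_pos_inject [simp]: "lower_pos j = lower_pos k \<longleftrightarrow> j = k"
  by (cases j; cases k) (auto simp del: lseq.simps)

lemma single_neq_orbit [simp]:
  "Out [e] j \<noteq> upper_neg k" "upper_neg k \<noteq> Out [e] j" "Out [e] j \<noteq> lower_pos k" "lower_pos k \<noteq> Out [e] j"
  by (cases k; simp)+

lemma upper_neq_lower [simp]: "upper_neg j \<noteq> lower_pos k" "lower_pos k \<noteq> upper_neg j"
  by (cases j; cases k; simp)+

lemma inj_orbit: "inj orbit"
proof (rule injI)
  fix i j assume "orbit i = orbit j"
  then show "i = j"
    by (cases i rule: orbit_cases; cases j rule: orbit_cases)
      (auto simp del: of_nat_Suc)
qed

lemma orbit_normal: "normal 3 (orbit i)"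
proof -
  have s: "[lseq k] \<notin> range cell_bottom" "[rseq k] \<notin> range cell_bottom" for k
    using seq_form[of k] by auto
  have "normal 3 (upper_neg k)" "normal 3 (lower_pos k)" for k
    using s[of k] s[of "k - 1"] seq_normal[of k] seq_normal[of "k - 1"] by (cases k; auto)+
  then show ?thesis
    using seq_normal s by (cases i rule: orbit_cases) (auto simp del: of_nat_Suc range_cell_bottom)
qed

text \<open>This keeps the two orbits apart from the hyperplanes crossed at the ends of a path,
  which are accounted for by \<open>skew\<close>.\<close>

lemma orbit_interior: "\<not> leftmost (orbit i)" "\<not> rightmost 3 (orbit i)"
proof -
  have "\<not> leftmost (rseq k)" "\<not> rightmost 3 (lseq k)" for k
    by (induction k) auto
  moreover have "\<not> leftmost (upper_neg k)" "\<not> rightmost 3 (upper_neg k)"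
    "\<not> leftmost (lower_pos k)" "\<not> rightmost 3 (lower_pos k)" for k
    by (cases k; simp)+
  ultimately show "\<not> leftmost (orbit i)" "\<not> rightmost 3 (orbit i)"
    by (cases i rule: orbit_cases; simp del: of_nat_Suc)+
qed

section \<open>Translation by \<open>g\<close>\<close>

definition g_path :: "edge list" where
  "g_path = bottom_path g_elem"

lemma g_path_eq: "g_path = [Out [Src 0] 0, Out [Out [Src 0] (Suc 0)] 0,
  Out [Out [Out [Out [Src 0] (Suc 0)] (Suc 0), Src 1] 0, Src 2] 0]"
  by (simp add: g_path_def g_explicit)

lemma g_path: "normal_path 3 g_path" "length g_path = 3" "g_elem = mk 3 g_path"
proof -
  obtain H where "g_elem = mk 3 H" "normal_path 3 H" "length H = 3"
    using g_in_diagram_group by (rule diagram_groupE)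
  moreover from this(1) have "g_path = H"
    unfolding g_path_def by (metis mk_simps(3))
  ultimately show "normal_path 3 g_path" "length g_path = 3" "g_elem = mk 3 g_path"
    by auto
qed

definition translate :: "edge \<Rightarrow> edge" where
  "translate = ev ((!) g_path)"

lemma translate_Src [simp]:
  "translate (Src 0) = Out [Src 0] 0" "translate (Src (Suc 0)) = Out [Out [Src 0] (Suc 0)] 0"
  "translate (Src 2) = Out [Out [Out [Out [Src 0] (Suc 0)] (Suc 0), Src 1] 0, Src 2] 0"
  by (simp_all add: translate_def g_path_eq eval_nat_numeral)

lemma translate_Out [simp]: "translate (Out p j) = flip (map translate p) ! j"
  by (simp add: translate_def)

lemma translate_seq [simp]: "translate (lseq n) = lseq (Suc n)" "translate (rseq (Suc n)) = rseq n"
  by (induction n) auto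

lemma translate_orbit: "translate (orbit (b, n)) = orbit (b, n + 1)"
proof -
  have u: "translate (upper_neg (Suc k)) = upper_neg k" for k
    by (cases k) (auto simp del: rseq.simps(2))
  have l: "translate (lower_pos k) = lower_pos (Suc k)" for k
    by (cases k) auto
  show ?thesis
  proof (cases "(b, n)" rule: orbit_cases)
    case (1 k)
    then show ?thesis
      using orbit_simps(1)[of "Suc k"] by (simp add: add.commute)
  next
    case (2 k)
    show ?thesis
    proof (cases k)
      \<comment> \<open>At place -1 the two formulas for the orbit meet.\<close>
      case 0
      then show ?thesis
        using 2 orbit_simps(1)[of 0] orbit_simps(2)[of 0] by simp
    next
      case (Suc k')
      then have n: "n = - int (Suc (Suc k'))" "n + 1 = - int (Suc k')" and b: "b = True"
        using 2 by auto
      show ?thesis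
        unfolding n(2) by (simp only: n(1) b orbit_simps u)
    qed
  next
    case (3 k)
    then show ?thesis
      using orbit_simps(3)[of "Suc k"] l by (simp add: add.commute del: lower_pos.simps)
  next
    case (4 k)
    show ?thesis
    proof (cases k)
      case 0
      then show ?thesis
        using 4 orbit_simps(3)[of 0] orbit_simps(4)[of 0] by simp
    next
      case (Suc k')
      then have n: "n = - int (Suc (Suc k'))" "n + 1 = - int (Suc k')" and b: "b = False"
        using 4 by auto
      show ?thesis
        unfolding n(2) by (simp only: n(1) b orbit_simps) (simp del: rseq.simps)
    qed
  qed
qed

text \<open>Substituting the bottom path of the inverse of \<open>g\<close> undoes the translation.
  So distinct hyperplanes stay distinct, which is what the translation of crossing numbers
  requires.\<close>

lemma translate_inj:
  assumes "normal 3 e" "normal 3 e'" "translate e = translate e'"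
  shows "e = e'"
proof -
  \<comment> \<open>the bottom path of the inverse of \<open>g\<close>\<close>
  define \<tau> where "\<tau> = (\<lambda>i::nat. if i = 0 then Out [Src 0, Out [Src 1, Out [Out [Src 2] 0] 0] 0] 0
    else if i = 1 then Out [Out [Src 2] 0] (Suc 0) else Out [Src 2] (Suc 0))"
  have \<tau>: "normal 3 (\<tau> i)" for i
    by (auto simp: \<tau>_def)
  have "ev \<tau> (g_path ! i) = Src i" if "i < 3" for i
    using that by (auto simp: less_Suc_eq eval_nat_numeral g_path_eq \<tau>_def)
  then have "ev \<tau> (translate e) = e" if "normal 3 e" for e
    using ev_ev[of 3 3 "(!) g_path" 3 \<tau> e] normal_well_formed[OF that] g_path normal_nth[of 3 g_path] \<tau>
      ev_cong[of 3 e "\<lambda>i. ev \<tau> (g_path ! i)" Src] ev_Src[OF that]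
    by (simp add: translate_def)
  then show ?thesis
    using assms by metis
qed

lemma map_translate_inj:
  assumes "normal_top 3 p" "normal_top 3 q"
  shows "map translate p = map translate q \<longleftrightarrow> p = q"
  using assms translate_inj inj_on_map_eq_map[of translate p q] by (auto simp: normal_top_def inj_on_def)

lemma map_translate_flip:
  "normal_top 3 p \<Longrightarrow> map translate (flip p) = flip (map translate p)"
  unfolding translate_def using g_path normal_nth by (intro map_ev_flip[where m = 3 and n = 3]) auto

text \<open>The first cell of \<open>g\<close> is an upper cell at the left end, the last one a
  lower cell at the right end; each contributes 1.\<close>

lemma skew_translate:
  assumes "normal_path 3 L"
  shows "skew (map translate L) = skew L + 2"
proof -
  have "skew (map (ev ((!) g_path)) L) = skew L + (skew g_path - skew (srcs 3))"
    by (rule additive_translate[OF g_path(1,2) additive_skew additive_skew _ assms]) (simp add: skew_step_def)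
  then show ?thesis
    by (simp add: translate_def skew_def g_path_eq srcs_def eval_nat_numeral)
qed

lemma crossing_translate:
  assumes "normal_path 3 L" "normal_top 3 p" "normal_top 3 (map translate p)"
  shows "crossing (map translate p) (map translate L) = crossing p L + crossing (map translate p) g_path"
proof -
  have "crossing (map translate p) (map (ev ((!) g_path)) L) =
      crossing p L + (crossing (map translate p) g_path - crossing p (srcs 3))"
  proof (rule additive_translate[OF g_path(1,2) additive_crossing additive_crossing _ assms(1)])
    fix q assume q: "normal_top 3 q"
    have "map translate q = map translate p \<longleftrightarrow> q = p"
      by (rule map_translate_inj[OF q assms(2)])
    moreover have "map translate q = flip (map translate p) \<longleftrightarrow> q = flip p"
      unfolding map_translate_flip[OF assms(2), symmetric]
      by (rule map_translate_inj[OF q flip_normal_top(2)[OF assms(2)]])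
    ultimately show "sign_at (map translate p) (map (ev ((!) g_path)) q) = sign_at p q"
      unfolding sign_at_def translate_def by simp
  qed (use assms in auto)
  then show ?thesis
    by (simp add: translate_def)
qed

text \<open>Of the cells of \<open>g\<close> just the second and the third belong to these orbits,
  both at place 0. The sign -1 arises because \<open>[orbit (False, 0)]\<close> is inverse to the
  third cell.\<close>

lemma crossing_orbit_g:
  "crossing [orbit (b, n)] g_path = (if b then 1 else - 1) * of_bool (n = 0)"
proof -
  have c: "cellsof g_path = {[Src 0], [Out [Src 0] (Suc 0)], [Out [Out [Src 0] (Suc 0)] (Suc 0), Src 1],
    [Out [Out [Out [Src 0] (Suc 0)] (Suc 0), Src 1] 0, Src 2]}"
    by (auto simp: g_path_eq)
  have l: "lseq k = Src 0 \<longleftrightarrow> k = 0" for k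
    by (cases k) auto
  show ?thesis
  proof (cases "(b, n)" rule: orbit_cases)
    case (1 k)
    then show ?thesis
      by (auto simp: crossing_def c l)
  next
    case (2 k)
    then show ?thesis
      by (cases k) (auto simp: crossing_def c simp del: of_nat_Suc)
  next
    case (3 k)
    then show ?thesis
      by (cases k) (auto simp: crossing_def c simp del: of_nat_Suc)
  next
    case (4 k)
    then show ?thesis
      by (auto simp: crossing_def c simp del: of_nat_Suc)
  qed
qed

lemma crossing_orbit_translate:
  assumes "normal_path 3 L"
  shows "crossing [orbit (b, n + 1)] (map translate L) =
    crossing [orbit (b, n)] L + (if b then 1 else - 1) * of_bool (n = - 1)"
proof -
  have t: "map translate [orbit (b, n)] = [orbit (b, n + 1)]"
    by (simp only: list.map translate_orbit)
  have o: "normal_top 3 [orbit i]" for i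
    by (simp add: normal_top_def orbit_normal)
  have "n + 1 = 0 \<longleftrightarrow> n = - 1"
    by auto
  then show ?thesis
    using crossing_translate[OF assms o, of "(b, n)", unfolded t, OF o] crossing_orbit_g[of b "n + 1"] by presburger
qed

text \<open>A bottom path has finitely many cells, and different places of an orbit have different
  names on either side.\<close>

lemma crossing_orbit_finite: "finite {n. crossing [orbit (b, n)] L \<noteq> 0}"
proof -
  let ?p = "\<lambda>n. [orbit (b, n)]"
  have inj: "inj ?p"
    using inj_orbit by (auto simp: inj_def)
  have ff: "flip (flip (?p n)) = ?p n" for n
    by (rule flip_normal_top(1)[of 3]) (simp add: normal_top_def orbit_normal)
  have inj': "inj (\<lambda>n. flip (?p n))"
  proof (rule injI)
    fix i j assume "flip (?p i) = flip (?p j)"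
    then have "?p i = ?p j"
      using ff[of i] ff[of j] by argo
    then show "i = j"
      by (rule injD[OF inj])
  qed
  have "{n. crossing (?p n) L \<noteq> 0} \<subseteq> ?p -` cellsof L \<union> (\<lambda>n. flip (?p n)) -` cellsof L"
    by (auto simp: crossing_def)
  then show ?thesis
    by (rule finite_subset) (intro finite_UnI finite_vimageI finite_cellsof inj inj')
qed

section \<open>The distance bound\<close>

lemma string_length_trans:
  "string_length m y z r \<Longrightarrow> string_length m z v r' \<Longrightarrow> string_length m y v (r + r')"
proof (induction rule: string_length.induct)
  case (step U \<Phi> s t z r)
  then show ?case
    using string_length.step[of m U \<Phi> s t v "r + r'"] by (simp add: add.assoc)
qed simp

text \<open>Connectedness of the complex shows that the infimum in \<open>complex_dist\<close> is
  taken over a nonempty set. Strings in both directions are recorded so that the relation is visibly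
  symmetric.\<close>

definition joined :: "nat \<Rightarrow> point \<Rightarrow> point \<Rightarrow> bool" where
  "joined m y z \<longleftrightarrow> (\<exists>r. string_length m y z r) \<and> (\<exists>r. string_length m z y r)"

lemma joined_sym: "joined m y z \<Longrightarrow> joined m z y"
  by (simp add: joined_def)

lemma joined_trans: "joined m y z \<Longrightarrow> joined m z v \<Longrightarrow> joined m y v"
  unfolding joined_def using string_length_trans by blast

lemma joined_refl: "y \<in> cube_complex m \<Longrightarrow> joined m y y"
  unfolding joined_def using string_length.refl by blast

lemma joined_cube:
  assumes "is_cube m U \<Phi>" "cube_coords \<Phi> s" "cube_coords \<Phi> t"
  shows "joined m (cube_point U \<Phi> s) (cube_point U \<Phi> t)"
proof -
  have "string_length m (cube_point U \<Phi> r) (cube_point U \<Phi> r) 0" if "cube_coords \<Phi> r" for r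
    by (rule string_length.refl) (use assms(1) that in \<open>auto simp: cube_complex_def\<close>)
  then show ?thesis
    unfolding joined_def using string_length.step[OF assms(1)] assms(2,3) by blast
qed

lemma path_attaches: "path n B \<Longrightarrow> attaches (srcs n) B"
  by (induction rule: path.induct) (auto simp: srcs_def intro: attaches.intros)

lemma cellsof_srcs [simp]: "cellsof (srcs n) = {}"
  by (simp add: srcs_def)

lemma trivial_prefix:
  assumes "is_diagram \<Phi>"
  shows "is_prefix (mk (top_word \<Phi>) (srcs (top_word \<Phi>))) \<Phi>" "is_prefix \<Phi> \<Phi>"
proof -
  have \<Phi>: "path (top_word \<Phi>) (bottom_path \<Phi>)" "\<Phi> = mk (top_word \<Phi>) (bottom_path \<Phi>)"
    using is_diagram_imp[OF assms] by auto
  show "is_prefix (mk (top_word \<Phi>) (srcs (top_word \<Phi>))) \<Phi>"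
    using is_prefix_mk[OF path_srcs path_attaches] \<Phi> by metis
  show "is_prefix \<Phi> \<Phi>"
    using is_prefix_mk[OF \<Phi>(1) attaches.refl] \<Phi>(2) by metis
qed

lemma product_srcs:
  assumes "U \<in> vertices m"
  shows "U \<odot> mk (bot_word U) (srcs (bot_word U)) = U"
proof -
  obtain L where L: "U = mk m L" "normal_path m L"
    using assms by (rule vertexE)
  have "length L \<ge> 1"
    using normal_path_ne[OF L(2)] by (simp add: Suc_leI)
  then have "is_diagram (mk (length L) (srcs (length L)))"
    by (simp add: srcs_def path.base)
  then show ?thesis
    using product_normal(1)[OF L(2), of "mk (length L) (srcs (length L))"] by (simp add: L map_ev_srcs)
qed

lemma cube_point_origin:
  assumes "is_cube m U \<Phi>"
  shows "cube_point U \<Phi> (\<lambda>_. 0) = vertex_point U"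
proof -
  have \<Phi>: "is_diagram \<Phi>" "thin \<Phi>" "top_word \<Phi> = bot_word U" "U \<in> vertices m"
    using assms by (auto simp: is_cube_def)
  show ?thesis
    using cube_point_corner[OF \<Phi>(1,2) trivial_prefix(1)[OF \<Phi>(1)], of U] product_srcs[OF \<Phi>(4)] \<Phi>(3) by simp
qed

lemma joined_vertex:
  assumes "is_cube m U \<Phi>" "cube_coords \<Phi> t"
  shows "joined m (cube_point U \<Phi> t) (vertex_point U)"
  using joined_cube[OF assms, of "\<lambda>_. 0"] cube_point_origin[OF assms(1)] by (simp add: cube_coords_def)

lemma joined_opposite:
  assumes "is_cube m U \<Phi>"
  shows "joined m (vertex_point U) (vertex_point (U \<odot> \<Phi>))"
proof -
  have \<Phi>: "is_diagram \<Phi>" "thin \<Phi>"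
    using assms by (auto simp: is_cube_def)
  have "joined m (cube_point U \<Phi> (\<lambda>_. 0)) (cube_point U \<Phi> (\<lambda>c. of_bool (c \<in> cells \<Phi>)))"
    by (rule joined_cube[OF assms]) (auto simp: cube_coords_def)
  then show ?thesis
    by (simp only: cube_point_origin[OF assms] cube_point_corner[OF \<Phi> trivial_prefix(2)[OF \<Phi>(1)]])
qed

lemma degenerate_cube:
  assumes "U \<in> vertices m"
  shows "is_cube m U (mk (bot_word U) (srcs (bot_word U)))"
proof -
  obtain L where L: "U = mk m L" "normal_path m L"
    using assms by (rule vertexE)
  have "length L \<ge> 1"
    using normal_path_ne[OF L(2)] by (simp add: Suc_leI)
  then show ?thesis
    using assms L by (auto simp: is_cube_def thin_def srcs_def path.base)
qed

lemma vertex_point_cube: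
  assumes "U \<in> vertices m"
  shows "vertex_point U = cube_point U (mk (bot_word U) (srcs (bot_word U))) (\<lambda>_. 0)"
  using cube_point_origin[OF degenerate_cube[OF assms]] by simp

lemma vertex_point_complex: "U \<in> vertices m \<Longrightarrow> vertex_point U \<in> cube_complex m"
  using vertex_point_cube degenerate_cube unfolding cube_complex_def cube_coords_def by fastforce

text \<open>The two vertices bound an edge of the complex, given by the thin diagram with one cell
  at the position of \<open>q\<close>.\<close>

lemma joined_flip:
  assumes "normal_path m (X @ q @ Y)" "valid q"
  shows "joined m (vertex_point (mk m (X @ q @ Y))) (vertex_point (mk m (X @ flip q @ Y)))"
proof -
  let ?L = "X @ q @ Y" and ?\<sigma> = "ev ((!) (X @ q @ Y))"
  let ?n = "length ?L"
  obtain P c Q where s: "srcs ?n = P @ c @ Q" "length P = length X" "length c = length q"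
  proof -
    have "srcs ?n = take (length X) (srcs ?n) @ take (length q) (drop (length X) (srcs ?n)) @
      drop (length q) (drop (length X) (srcs ?n))"
      by (metis append_take_drop_id)
    then show ?thesis
      by (rule that) auto
  qed
  have "map ?\<sigma> P @ map ?\<sigma> c @ map ?\<sigma> Q = X @ q @ Y"
    using map_ev_srcs[of ?L] unfolding s(1) by simp
  then have m: "map ?\<sigma> P = X" "map ?\<sigma> c = q" "map ?\<sigma> Q = Y"
    using s(2,3) by (simp_all add: append_eq_append_conv)
  have c: "valid c" "set c \<subseteq> set (srcs ?n)"
    using s(3) assms(2) unfolding s(1) by (auto simp: valid_def)
  have cl: "cellsof (P @ c @ Q) = {}"
    using cellsof_srcs[of ?n] unfolding s(1) by simp
  let ?\<Phi> = "mk ?n (P @ cell_bottom c @ Q)"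
  have "path ?n (P @ c @ Q)"
    using path.base[of ?n] valid_ne[OF assms(2)] unfolding s(1)[symmetric] srcs_def
    by (simp add: Suc_leI)
  then have path: "path ?n (P @ cell_bottom c @ Q)"
    using path.step c(1) by blast
  moreover have "thin ?\<Phi>"
    using cl c(2) by (auto simp: thin_def top_path_srcs)
  ultimately have cube: "is_cube m (mk m ?L) ?\<Phi>"
    using vertex_mk[OF assms(1)] by (simp add: is_cube_def)
  have "map ?\<sigma> (P @ cell_bottom c @ Q) = X @ flip q @ Y"
    using map_ev_cell_bottom_srcs[OF assms(1) c] m by simp
  then have "mk m ?L \<odot> ?\<Phi> = mk m (X @ flip q @ Y)"
    using product_normal(1)[OF assms(1), of ?\<Phi>] path by simp
  then show ?thesis
    using joined_opposite[OF cube] by simp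
qed

lemma joined_to_base:
  assumes "normal_path m L"
  shows "joined m (vertex_point (mk m (srcs m))) (vertex_point (mk m L))"
  using assms
proof (induction rule: normal_path_induct)
  case base
  have "path m (srcs m)"
    using path_srcs assms unfolding normal_path_def by blast
  then have "normal_path m (srcs m)"
    by (auto simp: normal_path_def)
  then show ?case
    by (intro joined_refl vertex_point_complex vertex_mk)
next
  case (flip X q Y)
  show ?case
    by (rule joined_trans[OF flip(4) joined_flip[OF flip(1,2)]])
qed

lemma joined_complex:
  assumes "y \<in> cube_complex m" "z \<in> cube_complex m"
  shows "joined m y z"
proof -
  have "joined m x (vertex_point (mk m (srcs m)))" if x: "x \<in> cube_complex m" for x
  proof -
    obtain U \<Phi> t where x: "x = cube_point U \<Phi> t" "is_cube m U \<Phi>" "cube_coords \<Phi> t"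
      using x unfolding cube_complex_def by blast
    then obtain L where L: "U = mk m L" "normal_path m L"
      using vertexE unfolding is_cube_def by blast
    show ?thesis
      using joined_trans[OF joined_vertex[OF x(2,3)] joined_sym[OF joined_to_base[OF L(2), folded L(1)]]] x(1)
      by simp
  qed
  then show ?thesis
    using joined_trans joined_sym assms by blast
qed

lemma act_complex:
  assumes "h \<in> diagram_group m" "y \<in> cube_complex m"
  shows "act h y \<in> cube_complex m"
  using assms act_cube_point is_cube_translate unfolding cube_complex_def by fastforce

section \<open>A map to Euclidean space that does not increase lengths\<close>

definition coordinate :: "(bool \<times> int) option \<Rightarrow> point \<Rightarrow> real" where
  "coordinate i y = (case i of None \<Rightarrow> lin_path skew y / sqrt 2 | Some j \<Rightarrow> lin_path (crossing [orbit j]) y)"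

lemma coordinate_diff:
  assumes "finite N"
  shows "L2_set (\<lambda>i. coordinate i y - coordinate i z) (insert None (Some ` N)) =
    sqrt ((lin_path skew y - lin_path skew z)\<^sup>2 / 2 +
      (\<Sum>i\<in>N. (lin_path (crossing [orbit i]) y - lin_path (crossing [orbit i]) z)\<^sup>2))"
  unfolding L2_set_def using assms
  by (simp add: coordinate_def sum.reindex power_divide flip: diff_divide_distrib)

text \<open>Each link of a string is bounded within its cube by \<open>cube_estimate\<close>, and
  the triangle inequality adds up the links.\<close>

lemma coordinates_le_string:
  assumes "string_length 3 y z r" "finite N"
  shows "L2_set (\<lambda>i. coordinate i y - coordinate i z) (insert None (Some ` N)) \<le> r"
  using assms(1)
proof (induction rule: string_length.induct)
  case (refl y)
  then show ?case by (simp add: L2_set_def)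
next
  case (step U \<Phi> s t z r)
  let ?I = "insert None (Some ` N)" and ?y = "cube_point U \<Phi> s" and ?x = "cube_point U \<Phi> t"
  have "L2_set (\<lambda>i. coordinate i ?y - coordinate i z) ?I \<le>
    L2_set (\<lambda>i. coordinate i ?y - coordinate i ?x) ?I + L2_set (\<lambda>i. coordinate i ?x - coordinate i z) ?I"
    using L2_set_triangle_ineq[of "\<lambda>i. coordinate i ?y - coordinate i ?x" "\<lambda>i. coordinate i ?x - coordinate i z" ?I]
    by simp
  moreover have "L2_set (\<lambda>i. coordinate i ?y - coordinate i ?x) ?I \<le> sqrt (\<Sum>c\<in>cells \<Phi>. (s c - t c)\<^sup>2)"
    unfolding coordinate_diff[OF assms(2)]
    using cube_estimate[OF step.hyps(1) assms(2) inj_orbit orbit_normal orbit_interior] by simp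
  ultimately show ?case
    using step.IH by linarith
qed

lemma g_translate_bottom:
  assumes "U \<in> vertices 3"
  shows "bottom_path (g_elem \<odot> U) = map translate (bottom_path U)" "normal_path 3 (bottom_path U)"
proof -
  obtain L where L: "U = mk 3 L" "normal_path 3 L"
    using assms by (rule vertexE)
  then have "is_diagram U"
    by (simp add: normal_path_def)
  then show "bottom_path (g_elem \<odot> U) = map translate (bottom_path U)" "normal_path 3 (bottom_path U)"
    using product_normal(1)[OF g_path(1), of U] L g_path(2,3) by (auto simp: translate_def)
qed

lemma skew_act:
  assumes "y \<in> cube_complex 3"
  shows "lin_path skew (act g_elem y) = lin_path skew y + 2"
  unfolding lin_act[OF g_in_diagram_group assms]
  by (rule lin_cong[OF assms]) (simp add: g_translate_bottom skew_translate)

lemma crossing_act: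
  assumes "y \<in> cube_complex 3"
  shows "lin_path (crossing [orbit (b, n)]) (act g_elem y) =
    lin_path (crossing [orbit (b, n - 1)]) y + (if b then 1 else - 1) * of_bool (n = 0)"
  unfolding lin_act[OF g_in_diagram_group assms]
proof (rule lin_cong[OF assms])
  fix U assume U: "U \<in> vertices 3"
  show "crossing [orbit (b, n)] (bottom_path (g_elem \<odot> U)) =
      crossing [orbit (b, n - 1)] (bottom_path U) + (if b then 1 else - 1) * of_bool (n = 0)"
    using crossing_orbit_translate[OF g_translate_bottom(2)[OF U], of b "n - 1"]
    unfolding g_translate_bottom(1)[OF U] by simp
qed

lemma finite_support:
  assumes "y \<in> cube_complex m"
  shows "finite {W. y W \<noteq> 0}"
  using assms finite_support_cube_point by (auto simp: cube_complex_def is_cube_def)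

lemma crossing_finite_support:
  assumes "y \<in> cube_complex m"
  shows "finite {n. lin_path (crossing [orbit (b, n)]) y \<noteq> 0}"
proof (rule finite_subset)
  show "{n. lin_path (crossing [orbit (b, n)]) y \<noteq> 0} \<subseteq>
    (\<Union>W\<in>{W. y W \<noteq> 0}. {n. crossing [orbit (b, n)] (bottom_path W) \<noteq> 0})"
  proof
    fix n assume "n \<in> {n. lin_path (crossing [orbit (b, n)]) y \<noteq> 0}"
    then obtain W where "y W \<noteq> 0" "y W * crossing [orbit (b, n)] (bottom_path W) \<noteq> 0"
      unfolding lin_def mem_Collect_eq by (rule sum.not_neutral_contains_not_neutral) blast
    then show "n \<in> (\<Union>W\<in>{W. y W \<noteq> 0}. {n. crossing [orbit (b, n)] (bottom_path W) \<noteq> 0})"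
      by auto
  qed
qed (simp add: finite_support[OF assms] crossing_orbit_finite)

text \<open>Telescoping, since \<open>g\<close> shifts the orbit by one place and crosses one of its hyperplanes.\<close>

lemma orbit_displacement:
  assumes "y \<in> cube_complex 3"
  obtains J where "finite J" "\<And>b. (\<Sum>n\<in>J. lin_path (crossing [orbit (b, n)]) (act g_elem y) -
    lin_path (crossing [orbit (b, n)]) y) = (if b then 1 else - 1)"
proof
  define a where "a b n = lin_path (crossing [orbit (b, n)]) y" for b n
  define F where "F = {n. a True n \<noteq> 0} \<union> {n. a False n \<noteq> 0}"
  \<comment> \<open>This contains the supports of \<open>a b n\<close> and of
    \<open>a b (n - 1)\<close> for both orbits, and the place 0 of the hyperplane crossed by
    \<open>g\<close>.\<close>
  define J where "J = insert 0 (F \<union> (\<lambda>n. n + 1) ` F)"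
  have F: "finite F"
    using crossing_finite_support[OF assms] by (simp add: F_def a_def)
  then show J: "finite J"
    by (simp add: J_def)
  fix b
  have z: "a b n = 0" if "n \<notin> F" for n
    using that by (cases b) (auto simp: F_def)
  have "(\<Sum>n\<in>J. a b (n - 1)) = (\<Sum>n\<in>(\<lambda>n. n - 1) ` J. a b n)"
    by (simp add: sum.reindex inj_on_def)
  also have "\<dots> = (\<Sum>n\<in>F. a b n)"
  proof (rule sum.mono_neutral_right)
    show "F \<subseteq> (\<lambda>n. n - 1) ` J"
    proof
      fix n assume "n \<in> F"
      then show "n \<in> (\<lambda>n. n - 1) ` J"
        by (intro image_eqI[of _ _ "n + 1"]) (auto simp: J_def)
    qed
  qed (use J z in auto)
  also have "\<dots> = (\<Sum>n\<in>J. a b n)"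
    by (rule sum.mono_neutral_left) (use J z in \<open>auto simp: J_def\<close>)
  finally have 1: "(\<Sum>n\<in>J. a b (n - 1)) = (\<Sum>n\<in>J. a b n)" .
  have "(\<Sum>n\<in>J. k * of_bool (n = 0)) = (\<Sum>n\<in>J. if n = 0 then k else 0)" for k :: real
    by (rule sum.cong) auto
  moreover have "0 \<in> J"
    by (simp add: J_def)
  ultimately have 2: "(\<Sum>n\<in>J. k * of_bool (n = 0)) = k" for k :: real
    using J by (simp only: sum.delta if_True)
  show "(\<Sum>n\<in>J. lin_path (crossing [orbit (b, n)]) (act g_elem y) -
      lin_path (crossing [orbit (b, n)]) y) = (if b then 1 else - 1)"
    unfolding crossing_act[OF assms] a_def[symmetric] sum_subtractf sum.distrib 1 2 by simp
qed

lemma dist_lower_bound: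
  assumes y: "y \<in> cube_complex 3"
  obtains J d where "finite J"
    "\<And>b n. d b n = lin_path (crossing [orbit (b, n)]) (act g_elem y) - lin_path (crossing [orbit (b, n)]) y"
    "\<And>b. \<bar>\<Sum>n\<in>J. d b n\<bar> = 1"
    "complex_dist 3 y (act g_elem y) \<ge> sqrt (2 + (\<Sum>n\<in>J. (d True n)\<^sup>2) + (\<Sum>n\<in>J. (d False n)\<^sup>2))"
proof -
  define d where
    "d b n = lin_path (crossing [orbit (b, n)]) (act g_elem y) - lin_path (crossing [orbit (b, n)]) y" for b n
  obtain J where J: "finite J" "\<And>b. (\<Sum>n\<in>J. d b n) = (if b then 1 else - 1)"
    using orbit_displacement[OF y] unfolding d_def by blast
  let ?N = "(UNIV :: bool set) \<times> J"
  have N: "finite ?N"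
    using J by simp
  have s: "(\<Sum>i\<in>?N. (d (fst i) (snd i))\<^sup>2) = (\<Sum>n\<in>J. (d True n)\<^sup>2) + (\<Sum>n\<in>J. (d False n)\<^sup>2)"
  proof -
    have "(\<Sum>i\<in>?N. (d (fst i) (snd i))\<^sup>2) = (\<Sum>b\<in>UNIV. \<Sum>n\<in>J. (d b n)\<^sup>2)"
      by (simp add: sum.cartesian_product split_def)
    then show ?thesis
      by (simp add: UNIV_bool add.commute)
  qed
  have "sqrt (2 + (\<Sum>n\<in>J. (d True n)\<^sup>2) + (\<Sum>n\<in>J. (d False n)\<^sup>2)) \<le> r"
    if "string_length 3 y (act g_elem y) r" for r
  proof -
    have "sqrt (2 + (\<Sum>i\<in>?N. (d (fst i) (snd i))\<^sup>2)) =
      L2_set (\<lambda>i. coordinate i y - coordinate i (act g_elem y)) (insert None (Some ` ?N))"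
    proof -
      have "(lin_path (crossing [orbit i]) y - lin_path (crossing [orbit i]) (act g_elem y))\<^sup>2 =
          (d (fst i) (snd i))\<^sup>2" for i
        unfolding d_def prod.collapse by (rule power2_commute)
      moreover have "(x - (x + 2))\<^sup>2 / 2 = 2" for x :: real
        by simp
      ultimately show ?thesis
        unfolding coordinate_diff[OF N] skew_act[OF y] by (simp only:)
    qed
    then show ?thesis
      using coordinates_le_string[OF that N] s by (simp add: add.assoc)
  qed
  \<comment> \<open>A lower bound for all strings bounds the infimum only if there is a string at
    all.\<close>
  moreover have "{r. string_length 3 y (act g_elem y) r} \<noteq> {}"
    using joined_complex[OF y act_complex[OF g_in_diagram_group y]] unfolding joined_def by blast
  ultimately have le: "sqrt (2 + (\<Sum>n\<in>J. (d True n)\<^sup>2) + (\<Sum>n\<in>J. (d False n)\<^sup>2)) \<le>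
      complex_dist 3 y (act g_elem y)"
    unfolding complex_dist_def by (intro cInf_greatest) blast+
  have "\<bar>\<Sum>n\<in>J. d b n\<bar> = 1" for b
    unfolding J(2) by simp
  then show ?thesis
    by (rule that[OF J(1) d_def _ le])
qed

text \<open>The absolute value of an integer is at most its square; for the integer
  \<open>k * d n\<close> this leaves one factor \<open>k\<close>. It is applied with
  \<open>k = 1\<close> at vertices and \<open>k = 2\<close> at midpoints.\<close>

lemma abs_sum_le_sum_squares:
  fixes d :: "'a \<Rightarrow> real"
  assumes "k > 0" "\<And>n. k * d n \<in> \<int>"
  shows "\<bar>\<Sum>n\<in>J. d n\<bar> \<le> k * (\<Sum>n\<in>J. (d n)\<^sup>2)"
proof -
  have "\<bar>d n\<bar> \<le> k * (d n)\<^sup>2" for n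
  proof -
    obtain i :: int where i: "k * d n = of_int i"
      using assms(2) by (auto elim: Ints_cases)
    have "\<bar>i\<bar> \<le> \<bar>i\<bar> * \<bar>i\<bar>"
      using mult_left_mono[of 1 "\<bar>i\<bar>" "\<bar>i\<bar>"] by (cases "i = 0") auto
    then have "\<bar>real_of_int i\<bar> \<le> (real_of_int i)\<^sup>2"
      by (metis abs_mult_self_eq of_int_abs of_int_le_iff of_int_mult power2_eq_square)
    then have "\<bar>k * d n\<bar> \<le> (k * d n)\<^sup>2"
      unfolding i .
    moreover have "\<bar>k * d n\<bar> = k * \<bar>d n\<bar>" "(k * d n)\<^sup>2 = k * (k * (d n)\<^sup>2)"
      using assms(1) by (simp_all add: abs_mult power2_eq_square)
    ultimately show ?thesis
      using assms(1) by simp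
  qed
  then have "(\<Sum>n\<in>J. \<bar>d n\<bar>) \<le> k * (\<Sum>n\<in>J. (d n)\<^sup>2)"
    unfolding sum_distrib_left by (rule sum_mono)
  then show ?thesis
    using sum_abs[of d J] by linarith
qed

section \<open>Integrality at vertices and midpoints\<close>

lemma crossing_Ints: "crossing p L \<in> \<int>"
  by (simp add: crossing_def of_bool_def)

lemma lin_vertex_point: "lin f (vertex_point U) = f U"
proof -
  have "{W. vertex_point U W \<noteq> 0} = {U}"
    by (auto simp: vertex_point_def)
  then show ?thesis
    by (simp add: lin_def vertex_point_def)
qed

lemma act_vertex_point:
  assumes "h \<in> diagram_group m" "U \<in> vertices m"
  shows "act h (vertex_point U) = vertex_point (h \<odot> U)"
  using act_cube_point[OF assms(1) degenerate_cube[OF assms(2)]] vertex_point_cube[OF assms(2)]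
    cube_point_origin[OF is_cube_translate[OF assms(1) degenerate_cube[OF assms(2)]]] by simp

text \<open>To the integer value at a corner of the cube every cell adds half of an increment 0, 1
  or -1.\<close>

lemma midpoint_Ints:
  assumes "is_cube m U \<Phi>" "normal_top m p"
  shows "2 * lin_path (crossing p) (cube_point U \<Phi> (\<lambda>_. 1 / 2)) \<in> \<int>"
proof -
  obtain L where U: "U = mk m L" and L: "normal_path m L"
    using assms(1) vertexE unfolding is_cube_def by blast
  have "2 * lin_path (crossing p) (cube_point U \<Phi> (\<lambda>_. 1 / 2)) =
    2 * crossing p L + (\<Sum>c\<in>cells \<Phi>. sign_at p (map (ev ((!) L)) c))"
    unfolding U lin_additive[OF additive_crossing[OF assms(2)] L assms(1)[unfolded U]]
      sum_distrib_left[symmetric] by simp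
  also have "\<dots> \<in> \<int>"
    by (intro Ints_add Ints_mult crossing_Ints Ints_sum) (auto simp: sign_at_def of_bool_def)
  finally show ?thesis .
qed

theorem proposition10:
  shows "(\<forall>y\<in>cube_complex 3. complex_dist 3 y (act g_elem y) > sqrt 2)
    \<and> (\<forall>U\<in>vertices 3. complex_dist 3 (vertex_point U) (act g_elem (vertex_point U)) \<ge> 2)
    \<and> (\<forall>y\<in>cube_midpoints 3. complex_dist 3 y (act g_elem y) \<ge> sqrt 2.25)"
proof (intro conjI ballI)
  fix y assume y_in: "y \<in> cube_complex 3"
  obtain J d where J: "finite J"
    and "\<And>b n. d b n = lin_path (crossing [orbit (b, n)]) (act g_elem y) -
      lin_path (crossing [orbit (b, n)]) y"
    and sum: "\<And>b. \<bar>\<Sum>n\<in>J. d b n\<bar> = 1"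
    and le: "complex_dist 3 y (act g_elem y) \<ge> sqrt (2 + (\<Sum>n\<in>J. (d True n)\<^sup>2) + (\<Sum>n\<in>J. (d False n)\<^sup>2))"
    by (rule dist_lower_bound[OF y_in]) (rule that; assumption)
  \<comment> \<open>Otherwise all displacements in this orbit would vanish, although their sum has
    absolute value 1.\<close>
  have "(\<Sum>n\<in>J. (d True n)\<^sup>2) \<noteq> 0"
  proof
    assume "(\<Sum>n\<in>J. (d True n)\<^sup>2) = 0"
    then have "\<forall>n\<in>J. d True n = 0"
      using J by (simp add: sum_nonneg_eq_0_iff)
    then show False
      using sum[of True] by simp
  qed
  moreover have "(\<Sum>n\<in>J. (d True n)\<^sup>2) \<ge> 0" "(\<Sum>n\<in>J. (d False n)\<^sup>2) \<ge> 0"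
    by (simp_all add: sum_nonneg)
  ultimately have "2 < 2 + (\<Sum>n\<in>J. (d True n)\<^sup>2) + (\<Sum>n\<in>J. (d False n)\<^sup>2)"
    by linarith
  then have "sqrt 2 < sqrt (2 + (\<Sum>n\<in>J. (d True n)\<^sup>2) + (\<Sum>n\<in>J. (d False n)\<^sup>2))"
    by (rule real_sqrt_less_mono)
  then show "complex_dist 3 y (act g_elem y) > sqrt 2"
    using le by linarith
next
  fix U assume U: "U \<in> vertices 3"
  obtain J d where "finite J" and d: "\<And>b n. d b n = lin_path (crossing [orbit (b, n)]) (act g_elem (vertex_point U)) -
      lin_path (crossing [orbit (b, n)]) (vertex_point U)"
    and J: "\<And>b. \<bar>\<Sum>n\<in>J. d b n\<bar> = 1"
    and le: "complex_dist 3 (vertex_point U) (act g_elem (vertex_point U)) \<ge>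
      sqrt (2 + (\<Sum>n\<in>J. (d True n)\<^sup>2) + (\<Sum>n\<in>J. (d False n)\<^sup>2))"
    by (rule dist_lower_bound[OF vertex_point_complex[OF U]]) (rule that; assumption)
  have "1 * d b n \<in> \<int>" for b n
    unfolding d act_vertex_point[OF g_in_diagram_group U] lin_vertex_point by (simp add: crossing_Ints)
  \<comment> \<open>Each orbit contributes at least 1, so the squared distance is at least 2 + 1 +
    1.\<close>
  then have "1 \<le> (\<Sum>n\<in>J. (d b n)\<^sup>2)" for b
    using abs_sum_le_sum_squares[of 1 "d b" J] J[of b] by simp
  from this[of True] this[of False]
  have "sqrt 4 \<le> sqrt (2 + (\<Sum>n\<in>J. (d True n)\<^sup>2) + (\<Sum>n\<in>J. (d False n)\<^sup>2))"
    by (intro real_sqrt_le_mono) linarith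
  then show "complex_dist 3 (vertex_point U) (act g_elem (vertex_point U)) \<ge> 2"
    using le by simp
next
  fix y assume "y \<in> cube_midpoints 3"
  then obtain U \<Phi> where y: "y = cube_point U \<Phi> (\<lambda>_. 1 / 2)" and cube: "is_cube 3 U \<Phi>"
    by (auto simp: cube_midpoints_def)
  have "cube_coords \<Phi> (\<lambda>_. 1 / 2)"
    by (simp add: cube_coords_def)
  then have y_in: "y \<in> cube_complex 3"
    unfolding cube_complex_def y using cube by blast
  obtain J d where "finite J" and d: "\<And>b n. d b n = lin_path (crossing [orbit (b, n)]) (act g_elem y) -
      lin_path (crossing [orbit (b, n)]) y"
    and J: "\<And>b. \<bar>\<Sum>n\<in>J. d b n\<bar> = 1"
    and le: "complex_dist 3 y (act g_elem y) \<ge> sqrt (2 + (\<Sum>n\<in>J. (d True n)\<^sup>2) + (\<Sum>n\<in>J. (d False n)\<^sup>2))"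
    by (rule dist_lower_bound[OF y_in]) (rule that; assumption)
  have p: "normal_top 3 [orbit i]" for i
    by (simp add: normal_top_def orbit_normal)
  have "2 * d b n \<in> \<int>" for b n
    unfolding d y act_cube_point[OF g_in_diagram_group cube] right_diff_distrib
    by (rule Ints_diff[OF midpoint_Ints[OF is_cube_translate[OF g_in_diagram_group cube] p] midpoint_Ints[OF cube p]])
  then have "1 \<le> 2 * (\<Sum>n\<in>J. (d b n)\<^sup>2)" for b
    using abs_sum_le_sum_squares[of 2 "d b" J] J[of b] by simp
  from this[of True] this[of False]
  \<comment> \<open>Each orbit contributes at least 1/2.\<close>
  have "3 \<le> 2 + (\<Sum>n\<in>J. (d True n)\<^sup>2) + (\<Sum>n\<in>J. (d False n)\<^sup>2)"
    by linarith
  moreover have "(2.25 :: real) \<le> 3"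
    by simp
  ultimately have "sqrt 2.25 \<le> sqrt (2 + (\<Sum>n\<in>J. (d True n)\<^sup>2) + (\<Sum>n\<in>J. (d False n)\<^sup>2))"
    by (intro real_sqrt_le_mono) (rule order_trans)
  then show "complex_dist 3 y (act g_elem y) \<ge> sqrt 2.25"
    using le by linarith
qed

end
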